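(* Let $(X_n)_{n\ge 1}$ be a sequence of i.i.d. random vectors with the same law as $X$, and let $(\widehat\theta_n)_{n\ge1}$ be the projected Robbins-Monro sequence defined in the context, with step sequence of the form $\gamma_n=c_\gamma n^{-\alpha}$, where $c_\gamma>0$ and $\alpha\in(1/2,1)$. Assume that [A1], [A2] and [A3] hold. Then there is a positive constant $C_1$ such that for all $n\ge1$, $$\mathbb E\left[\|\widehat\theta_n-\theta\|^2\right]\le\frac{C_1}{n^\alpha}.$$ Moreover, for every positive integer $p$ such that $\mathbb E[\|X-\mu\|^{2p}]<\infty$, there is a positive constant $C_p$ such that for all $n\ge1$, $$\mathbb E\left[\|\widehat\theta_n-\theta\|^{2p}\right]\le\frac{C_p}{n^{p\alpha}},$$ and for all $n\ge1$, $$\mathbb P\left[\widehat\theta_n-\gamma_n\nabla_yg(X_{n+1},\widehat\theta_n)\notin\mathcal K\right]\le\frac{C_p}{d_{\min}^{2p}\,n^{p\alpha}},$$ where $d_{\min}:=\inf_{y\in\partial\mathcal K}\|y-\theta\|$ and $\partial\mathcal K$ is the boundary of $\mathcal K$.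
   Context: Model. Let $d\ge2$ and let $X$ be a random vector of $\mathbb R^d$ of the form $X=\mu+r\,W\,U_\Omega$, where $\mu\in\mathbb R^d$, $r>0$, $W$ is a positive real continuous random variable (with a bounded density if $d=2$), $U_\Omega$ is uniformly distributed on a measurable subset $\Omega$ (of positive surface measure) of the unit sphere of $\mathbb R^d$, and $W$ and $U_\Omega$ are independent. Set $r^\star:=r\,\mathbb E[W]$ and $\theta:=(\mu,r^\star)\in\mathbb R^d\times\mathbb R$. Norms are Euclidean, $\langle\cdot,\cdot\rangle$ is the usual inner product, $\mathcal B(x,\rho)$ is the ball of center $x$ and radius $\rho$, and $\lambda_{\max}(M)$ is the largest eigenvalue of the matrix $M$. Assumptions. [A1] $\mathbb E[\|X-\mu\|^{-2}]<\infty$. [A2] $\mathbb E[\|X-\mu\|^{2}]<\infty$. [A3] There are positive constants $R_\mu,R_r$ such that $$\sup_{z\in\overline{\mathcal B(\mu,R_\mu)}}\lambda_{\max}(\Gamma(z))<\frac{1-\|\mathbb E[U_\Omega]\|^2/A}{r^\star+\frac32R_r}$$ for some $A$ with $\|\mathbb E[U_\Omega]\|^2<A<1$, where $$\Gamma(z):=\mathbb E\left[\frac1{\|X-z\|}\left(I_d-\frac{(X-z)(X-z)^T}{\|X-z\|^2}\right)\right].$$ Compact set and projection. With $R_\mu,R_r$ the constants of [A3], $\mathcal K$ is a compact convex subset of $\mathbb R^d\times(0,\infty)$ contained in $\overline{\mathcal B(\mu,R_\mu)}\times\overline{\mathcal B(r^\star,R_r)}$ such that $\theta\in\mathcal K\setminus\partial\mathcal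 K$ ($\partial\mathcal K$ is the boundary of $\mathcal K$ in $\mathbb R^d\times\mathbb R$). The map $\pi:\mathbb R^d\times\mathbb R\to\mathcal K$ is a projection onto $\mathcal K$ satisfying: $\pi(y)=y$ for $y\in\mathcal K$; $\|\pi(y)-\pi(y')\|\le\|y-y'\|$ for all $y,y'$; and $\pi(y)\in\partial\mathcal K$ for all $y\notin\mathcal K$. Projected Robbins-Monro algorithm. For $x\in\mathbb R^d$ and $y=(z,a)\in\mathbb R^d\times(0,\infty)$ let $g(x,y):=\frac12(\|x-z\|-a)^2$, so that for $x\neq z$ $$\nabla_yg(x,y)=\begin{pmatrix}z-x-a\,\frac{z-x}{\|z-x\|}\\ a-\|z-x\|\end{pmatrix}.$$ (For each fixed $z$, $X\ne z$ almost surely.) The sequence is defined by $\widehat\theta_1$ arbitrarily chosen in $\mathcal K$ and, for $n\ge1$, $$\widehat\theta_{n+1}=\pi\left(\widehat\theta_n-\gamma_n\nabla_yg(X_{n+1},\widehat\theta_n)\right).$$ *)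

theory Defs
  imports "HOL-Probability.Probability"
begin

text \<open>
  Surface measure of the unit sphere, by polar coordinates: the measure of a Borel subset \<open>A\<close> of
  the sphere is the dimension times the Lebesgue measure of the cone over \<open>A\<close> inside the unit
  ball. Here \<open>sgn x\<close> is \<open>x / norm x\<close>, so the cone is the preimage of \<open>A\<close> under \<open>sgn\<close>.
  As a measure on the whole space, it is concentrated on \<open>sphere 0 1\<close>.
\<close>
definition sphere_measure :: "'a::euclidean_space measure" where
  "sphere_measure =
     scale_measure (of_nat DIM('a)) (distr (restrict_space lborel (cball 0 1)) borel sgn)"

text \<open>
  Independence of two random variables. The library constant \<open>indep_var\<close> requires both variables
  to have the same value type; this is the same notion (cf. \<open>indep_var_eq\<close>) without that
  restriction.
\<close>
definition (in prob_space) indep_rvs ::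
    "'b measure \<Rightarrow> ('a \<Rightarrow> 'b) \<Rightarrow> 'c measure \<Rightarrow> ('a \<Rightarrow> 'c) \<Rightarrow> bool" where
  "indep_rvs S Y T Z \<longleftrightarrow>
     random_variable S Y \<and> random_variable T Z \<and>
     indep_set (sets (vimage_algebra (space M) Y S)) (sets (vimage_algebra (space M) Z T))"

lemma (in prob_space) indep_rvs_eq_indep_var: "indep_rvs S Y T Z \<longleftrightarrow> indep_var S Y T Z"
  unfolding indep_rvs_def indep_var_eq sets_vimage_algebra conj_assoc
  by (rule refl)

definition eigenvalues :: "real^'n^'n \<Rightarrow> real set" where
  "eigenvalues A = {c. \<exists>v. v \<noteq> 0 \<and> A *v v = c *\<^sub>R v}"

definition lambda_max :: "real^'n^'n \<Rightarrow> real" where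
  "lambda_max A = Max (eigenvalues A)"

definition outer :: "real^'n \<Rightarrow> real^'n \<Rightarrow> real^'n^'n" where
  "outer v w = (\<chi> i j. v $ i * w $ j)"

definition Gamma_mat :: "'w measure \<Rightarrow> ('w \<Rightarrow> real^'n) \<Rightarrow> real^'n \<Rightarrow> real^'n^'n" where
  "Gamma_mat M X z =
     (\<integral>\<omega>. (1 / norm (X \<omega> - z)) *\<^sub>R
           (mat 1 - (1 / (norm (X \<omega> - z))\<^sup>2) *\<^sub>R outer (X \<omega> - z) (X \<omega> - z)) \<partial>M)"

definition g :: "real^'n \<Rightarrow> (real^'n) \<times> real \<Rightarrow> real" where
  "g x y = (norm (x - fst y) - snd y)\<^sup>2 / 2"

text \<open>
  The gradient of \<open>g x\<close>, totalised to \<open>x = fst y\<close> (where \<open>g x\<close> may fail to be differentiable) by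
  the convention \<open>0 / 0 = 0\<close>.
\<close>
definition grad_g :: "real^'n \<Rightarrow> (real^'n) \<times> real \<Rightarrow> (real^'n) \<times> real" where
  "grad_g x y =
     (let z = fst y; a = snd y
      in (z - x - (a / norm (z - x)) *\<^sub>R (z - x), a - norm (z - x)))"

lemma grad_g_is_gradient:
  assumes "x \<noteq> fst y"
  shows "(g x has_derivative (\<lambda>h. grad_g x y \<bullet> h)) (at y)"
proof -
  have ne: "norm (fst y - x) \<noteq> 0"
    using assms by simp
  have eq: "g x = (\<lambda>y. (norm (fst y - x) - snd y)\<^sup>2 / 2)"
    by (simp add: fun_eq_iff g_def norm_minus_commute)
  have d1: "((\<lambda>y. fst y - x) has_derivative fst) (at y)"
    by (auto intro!: derivative_eq_intros)
  have d2: "(norm has_derivative (\<lambda>h. h \<bullet> sgn (fst y - x))) (at (fst y - x))"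
    using assms by (simp add: has_derivative_norm)
  have d: "((\<lambda>y. norm (fst y - x)) has_derivative (\<lambda>h. fst h \<bullet> sgn (fst y - x))) (at y)"
    using has_derivative_compose[OF d1 d2] .
  have "((\<lambda>y. (norm (fst y - x) - snd y)\<^sup>2 / 2) has_derivative
          (\<lambda>h. (norm (fst y - x) - snd y) * (fst h \<bullet> sgn (fst y - x) - snd h))) (at y)"
    by (rule derivative_eq_intros d refl | simp add: field_simps fun_eq_iff)+
  moreover have "(norm (fst y - x) - snd y) * (fst h \<bullet> sgn (fst y - x) - snd h) = grad_g x y \<bullet> h" for h
  proof -
    define v where "v = fst y - x"
    have "(norm v - snd y) * (fst h \<bullet> sgn v - snd h) =
            (v - (snd y / norm v) *\<^sub>R v) \<bullet> fst h + (snd y - norm v) * snd h"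
      using ne by (simp add: v_def[symmetric] sgn_div_norm inner_commute[of "fst h"]
          inner_diff_left field_simps)
    then show ?thesis
      by (simp add: grad_g_def Let_def inner_prod_def v_def)
  qed
  ultimately show ?thesis
    by (simp add: eq)
qed

end

theory Submission
  imports Defs
begin

text \<open>
  Write \<open>\<phi> t = norm (t *\<^sub>R h - v)\<close> with \<open>v = X - \<mu>\<close> and \<open>h = z - \<mu>\<close>. Up to terms with explicit
  expectation, the inner product of the gradient at \<open>y = (z, a)\<close> with \<open>y - \<theta>\<close> is a combination of
  \<open>\<phi>' 1 - \<phi>' 0\<close> and \<open>\<phi> 1 - \<phi> 0 - \<phi>' 0\<close>, that is, a weighted integral of \<open>\<phi>''\<close> over \<open>{0..1}\<close>. The
  expectation of \<open>\<phi>''\<close> is the quadratic form of \<open>\<Gamma>(\<mu> + t h)\<close> in the direction \<open>h\<close>, so that [A3] makes the mean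
  gradient strongly monotone at \<open>\<theta>\<close>.

  The exchange of integrals needs \<open>\<Gamma>(\<mu> + t h)\<close> to be integrable for almost every \<open>t\<close>. The function
  \<open>1 / norm\<close> is integrable on balls in dimension at least two, so by Tonelli this holds for almost
  every direction \<open>h\<close>, whatever the law of \<open>X\<close>. Since \<open>X\<close> has no atoms, the resulting inequality
  is continuous in \<open>h\<close> and extends to all directions.

  For the \<open>p\<close>-th power of the squared error \<open>D\<close>, every term of second or higher order in the step size \<open>g\<close>
  is at most a constant times \<open>(g / T) * (D ^ p + (g * T) ^ p)\<close>. With \<open>T\<close> large this is absorbed by the
  contraction, and the recursion \<open>v (n + 1) \<le> (1 - a * g) * v n + B * g ^ (p + 1)\<close> gives the rate \<open>g ^ p\<close>.
  An exit from \<open>K\<close> puts the next iterate on the boundary, so Markov's inequality gives the last bound.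
\<close>

section \<open>The largest eigenvalue of a symmetric matrix\<close>

lemma symmetric_matrix_inner:
  fixes A :: "real^'n^'n"
  assumes "transpose A = A"
  shows "v \<bullet> (A *v w) = (A *v v) \<bullet> w"
  using dot_lmul_matrix[of v A w] transpose_matrix_vector[of A v] assms by simp

text \<open>Perturb \<open>v\<close> in the direction \<open>w = B *v v\<close>: the form at
  \<open>v + t *\<^sub>R w\<close> equals \<open>2 * t * (w \<bullet> w) + t\<^sup>2 * b\<close>,
  which is negative for small negative \<open>t\<close> unless \<open>w = 0\<close>.\<close>

lemma psd_form_zero:
  fixes B :: "real^'n^'n"
  assumes sym: "transpose B = B" and psd: "\<And>x. 0 \<le> x \<bullet> (B *v x)" and z: "v \<bullet> (B *v v) = 0"
  shows "B *v v = 0"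
proof -
  define w where "w = B *v v"
  define b where "b = w \<bullet> (B *v w)"
  have s: "v \<bullet> (B *v w) = w \<bullet> w"
    unfolding w_def by (rule symmetric_matrix_inner[OF sym])
  have ineq: "0 \<le> 2 * t * (w \<bullet> w) + t\<^sup>2 * b" for t :: real
    using psd[of "v + t *\<^sub>R w"] z s
    by (simp add: matrix_vector_right_distrib inner_add_left inner_add_right
      matrix_vector_mult_scaleR w_def[symmetric] b_def[symmetric] power2_eq_square algebra_simps)
  have b0: "0 \<le> b" unfolding b_def by (rule psd)
  have "w \<bullet> w \<le> 0"
  proof (rule ccontr)
    assume "\<not> w \<bullet> w \<le> 0"
    then have p: "w \<bullet> w > 0" by linarith
    \<comment> \<open>The minimiser would be \<open>- (w \<bullet> w) / b\<close>. Adding 1 to the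
      denominator covers \<open>b = 0\<close> and still gives a negative value.\<close>
    define t where "t = - (w \<bullet> w) / (b + 1)"
    have tb: "t * (b + 1) = - (w \<bullet> w)" using b0 by (simp add: t_def)
    have tn: "t < 0" using p b0 by (simp add: t_def divide_neg_pos)
    have "2 * t * (w \<bullet> w) + t\<^sup>2 * b = t * (2 * (w \<bullet> w) + (t * (b + 1) - t))"
      by (simp add: power2_eq_square algebra_simps)
    also have "\<dots> = t * (w \<bullet> w - t)" unfolding tb by simp
    also have "\<dots> < 0" by (intro mult_neg_pos) (use p tn in linarith)+
    finally show False using ineq[of t] by simp
  qed
  then have "w \<bullet> w = 0" using inner_ge_zero[of w] by linarith
  then show ?thesis by (simp add: w_def[symmetric])
qed

text \<open>Eigenvectors for distinct eigenvalues are orthogonal, hence independent, hence finitely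
  many. Finiteness makes the \<open>Max\<close> in \<open>lambda_max\<close> meaningful.\<close>

lemma finite_eigenvalues:
  fixes A :: "real^'n^'n"
  assumes sym: "transpose A = A"
  shows "finite (eigenvalues A)"
proof -
  define ev where "ev c = (SOME v. v \<noteq> 0 \<and> A *v v = c *\<^sub>R v)" for c
  have ev: "ev c \<noteq> 0 \<and> A *v ev c = c *\<^sub>R ev c" if "c \<in> eigenvalues A" for c
    using that unfolding ev_def eigenvalues_def mem_Collect_eq by (rule someI_ex)
  have orth: "ev c \<bullet> ev d = 0" if "c \<in> eigenvalues A" "d \<in> eigenvalues A" "c \<noteq> d" for c d
  proof -
    have "(A *v ev c) \<bullet> ev d = ev c \<bullet> (A *v ev d)"
      by (rule symmetric_matrix_inner[OF sym, symmetric])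
    then show ?thesis using ev[OF that(1)] ev[OF that(2)] that(3) by simp
  qed
  have inj: "inj_on ev (eigenvalues A)"
    using ev orth by (intro inj_onI) (metis inner_eq_zero_iff)
  have "pairwise orthogonal (ev ` eigenvalues A)"
    unfolding pairwise_def orthogonal_def using orth by (auto simp: inj_on_eq_iff[OF inj])
  then have "independent (ev ` eigenvalues A)"
    using ev by (intro pairwise_orthogonal_independent) auto
  then have "finite (ev ` eigenvalues A)" using independent_imp_finite by blast
  then show ?thesis using finite_imageD inj by blast
qed

text \<open>By compactness the form has a maximum \<open>l\<close> on the unit sphere, attained at
  some \<open>v\<close>. Then \<open>l *\<^sub>R mat 1 - A\<close> is positive semidefinite with
  vanishing form at \<open>v\<close>, so \<open>psd_form_zero\<close> makes \<open>v\<close> an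
  eigenvector for \<open>l\<close>.\<close>

lemma rayleigh_le_lambda_max:
  fixes A :: "real^'n^'n"
  assumes sym: "transpose A = A"
  shows "x \<bullet> (A *v x) \<le> lambda_max A * (norm x)\<^sup>2"
proof -
  have "continuous_on (sphere 0 1) (\<lambda>x. x \<bullet> (A *v x))"
    by (intro continuous_intros matrix_vector_mult_linear_continuous_on)
  moreover have "sphere (0 :: real^'n) 1 \<noteq> {}" by simp
  ultimately obtain v where v: "norm v = 1"
    and max: "\<And>x. norm x = 1 \<Longrightarrow> x \<bullet> (A *v x) \<le> v \<bullet> (A *v v)"
    using continuous_attains_sup[OF compact_sphere, of 0 1 "\<lambda>x. x \<bullet> (A *v x)"] by auto
  define l where "l = v \<bullet> (A *v v)"
  have bound: "x \<bullet> (A *v x) \<le> l * (norm x)\<^sup>2" for x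
  proof (cases "x = 0")
    case False
    then have n: "norm x \<noteq> 0" by simp
    have "x \<bullet> (A *v x) = (norm x)\<^sup>2 * (sgn x \<bullet> (A *v sgn x))"
      using n by (simp add: sgn_div_norm matrix_vector_mult_scaleR power2_eq_square field_simps)
    also have "\<dots> \<le> (norm x)\<^sup>2 * l"
      unfolding l_def using False by (intro mult_left_mono max) (simp_all add: norm_sgn)
    finally show ?thesis by (simp add: mult.commute)
  qed simp
  define B where "B = l *\<^sub>R mat 1 - A"
  have Bx: "B *v x = l *\<^sub>R x - A *v x" for x
    by (simp add: B_def matrix_vector_mult_diff_rdistrib scaleR_matrix_vector_assoc[symmetric])
  have "transpose B = B"
    using sym by (simp add: B_def transpose_def vec_eq_iff mat_def) 
  moreover have "0 \<le> x \<bullet> (B *v x)" for x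
    using bound[of x] by (simp add: Bx inner_diff_right power2_norm_eq_inner)
  moreover have "v \<bullet> (B *v v) = 0"
    using v by (simp add: Bx inner_diff_right l_def power2_norm_eq_inner[symmetric])
  ultimately have "B *v v = 0" by (rule psd_form_zero)
  then have "A *v v = l *\<^sub>R v" by (simp add: Bx)
  moreover have "v \<noteq> 0" using v by auto
  ultimately have "l \<in> eigenvalues A" by (auto simp: eigenvalues_def)
  then have "l \<le> lambda_max A" 
    unfolding lambda_max_def by (rule Max_ge[OF finite_eigenvalues[OF sym]])
  then show ?thesis using bound[of x] mult_right_mono[of l "lambda_max A" "(norm x)\<^sup>2"] by simp
qed

lemma norm_outer: "norm (outer v w) = norm v * norm w"
proof -
  have "norm (outer v w) = L2_set (\<lambda>i. norm (v $ i *\<^sub>R w)) UNIV"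
    unfolding norm_vec_def[of "outer v w"]
  proof (rule L2_set_cong[OF refl])
    fix i
    have "outer v w $ i = v $ i *\<^sub>R w" by (simp add: outer_def vec_eq_iff)
    then show "norm (outer v w $ i) = norm (v $ i *\<^sub>R w)" by simp
  qed
  also have "\<dots> = L2_set (\<lambda>i. norm (v $ i)) UNIV * norm w"
    by (simp add: L2_set_left_distrib)
  finally show ?thesis by (simp add: norm_vec_def[of v])
qed

lemma outer_matrix_vector: "outer v w *v x = (w \<bullet> x) *\<^sub>R v"
proof -
  have "(outer v w *v x) $ i = ((w \<bullet> x) *\<^sub>R v) $ i" for i
    unfolding outer_def matrix_vector_mult_def inner_vec_def
    by (simp add: sum_distrib_right, intro sum.cong) auto
  then show ?thesis by (simp add: vec_eq_iff)
qed

section \<open>Integrability of the inverse distance in almost every direction\<close>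

text \<open>For \<open>s\<close> strictly between 0 and 1, the single term with
  \<open>1 / 2 ^ (k + 1) < s \<le> 1 / 2 ^ k\<close> already dominates \<open>1 / s\<close>.
  Replacing the singularity by indicators of balls reduces its integral to volumes.\<close>

lemma inverse_le_dyadic_sum:
  fixes s :: real
  assumes "s \<ge> 0"
  shows "ennreal (1 / s) \<le> 1 + (\<Sum>k. ennreal (2 ^ (k + 1)) * indicator {..1 / 2 ^ k} s)"
    (is "_ \<le> 1 + suminf ?f")
proof (cases "s = 0 \<or> s \<ge> 1")
  \<comment> \<open>Since \<open>1 / 0 = 0\<close>, the left side is at most 1 for
    \<open>s = 0\<close> as well.\<close>
  case True
  then have "1 / s \<le> 1" by auto
  then have "ennreal (1 / s) \<le> 1" by (metis ennreal_1 ennreal_leI)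
  then show ?thesis by (rule order_trans) simp
next
  case False
  then have s: "0 < s" "s < 1" using assms by auto
  obtain m where m: "(1 / 2) ^ m < s" using real_arch_pow_inv[of s "1 / 2"] s by auto
  define n where "n = (LEAST m. (1 / 2 :: real) ^ m < s)"
  have n: "(1 / 2) ^ n < s" unfolding n_def using m by (rule LeastI)
  then obtain k where k: "n = Suc k" using s by (cases n) auto
  have "\<not> (1 / 2) ^ k < s" using not_less_Least[of k "\<lambda>m. (1 / 2 :: real) ^ m < s"] k n_def by auto
  then have ks: "s \<le> 1 / 2 ^ k" by (simp add: power_one_over)
  have "1 / s \<le> 2 ^ (k + 1)" using n s k by (simp add: power_one_over field_simps)
  then have "ennreal (1 / s) \<le> ?f k" using ks by (simp add: ennreal_leI)
  also have "?f k = sum ?f {k}" by (simp only: sum.insert sum.empty finite.emptyI empty_iff add_0_right not_False_eq_True)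
  also have "\<dots> \<le> suminf ?f" by (intro sum_le_suminf) auto
  finally show ?thesis by (rule order_trans) simp
qed

lemma cball_measurable [measurable]: "cball (a :: 'a::metric_space) r \<in> sets borel"
  by simp

text \<open>In dimension at least two the ball of radius \<open>1 / 2 ^ k\<close> has volume at most
  a constant times \<open>(1 / 2 ^ k) ^ 2\<close>, which beats the factor \<open>2 ^ (k + 1)\<close>
  and leaves a geometric series. The bound does not depend on the pole \<open>y\<close>, so it
  survives averaging over any law of the pole.\<close>

lemma nn_integral_inverse_norm_le:
  fixes y :: "'a::euclidean_space"
  assumes S [measurable]: "S \<in> sets borel" and dim: "DIM('a) \<ge> 2"
  shows "(\<integral>\<^sup>+h. ennreal (1 / norm (h - y)) * indicator S h \<partial>lborel)
    \<le> emeasure lborel S + ennreal (4 * unit_ball_vol (real DIM('a)))"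
proof -
  let ?V = "unit_ball_vol (real DIM('a))"
  have "(\<integral>\<^sup>+h. ennreal (1 / norm (h - y)) * indicator S h \<partial>lborel)
    \<le> (\<integral>\<^sup>+h. indicator S h + (\<Sum>k. ennreal (2 ^ (k + 1)) * indicator (cball y (1 / 2 ^ k)) h) \<partial>lborel)"
  proof (rule nn_integral_mono)
    fix h
    have "(\<Sum>k. ennreal (2 ^ (k + 1)) * indicator {..1 / 2 ^ k} (norm (h - y)))
      = (\<Sum>k. ennreal (2 ^ (k + 1)) * indicator (cball y (1 / 2 ^ k)) h)"
      by (intro arg_cong[where f = suminf] ext arg_cong2[where f = "(*)"] refl)
        (auto simp: indicator_def dist_norm norm_minus_commute)
    then show "ennreal (1 / norm (h - y)) * indicator S h
      \<le> indicator S h + (\<Sum>k. ennreal (2 ^ (k + 1)) * indicator (cball y (1 / 2 ^ k)) h)"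
      using inverse_le_dyadic_sum[of "norm (h - y)"] by (auto simp: indicator_def)
  qed
  also have "\<dots> = emeasure lborel S
      + (\<Sum>k. ennreal (2 ^ (k + 1)) * emeasure lborel (cball y (1 / 2 ^ k)))"
  proof -
    have "(\<integral>\<^sup>+h. (\<Sum>k. ennreal (2 ^ (k + 1)) * indicator (cball y (1 / 2 ^ k)) h) \<partial>lborel)
      = (\<Sum>k. ennreal (2 ^ (k + 1)) * emeasure lborel (cball y (1 / 2 ^ k)))"
    proof -
      have "(\<integral>\<^sup>+h. ennreal (2 ^ (k + 1)) * indicator (cball y (1 / 2 ^ k)) h \<partial>lborel)
        = ennreal (2 ^ (k + 1)) * emeasure lborel (cball y (1 / 2 ^ k))" for k :: nat
        by (rule nn_integral_cmult_indicator) simp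
      moreover have "(\<lambda>h. ennreal (2 ^ (k + 1)) * indicator (cball y (1 / 2 ^ k)) h) \<in> borel_measurable lborel" for k :: nat
        by (intro borel_measurable_times_ennreal borel_measurable_const borel_measurable_indicator) simp
      ultimately show ?thesis by (simp only: nn_integral_suminf)
    qed
    then show ?thesis by (subst nn_integral_add) simp_all
  qed
  also have "(\<Sum>k. ennreal (2 ^ (k + 1)) * emeasure lborel (cball y (1 / 2 ^ k)))
      \<le> (\<Sum>k. ennreal (2 * ?V * (1 / 2) ^ k))"
  proof (intro suminf_le)
    fix k :: nat
    have "(1 / 2 ^ k) ^ DIM('a) \<le> (1 / 2 ^ k :: real) ^ 2"
      by (rule power_decreasing[OF dim]) auto
    then have "2 ^ (k + 1) * (?V * (1 / 2 ^ k) ^ DIM('a)) \<le> 2 ^ (k + 1) * (?V * (1 / 2 ^ k) ^ 2)"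
      by (intro mult_left_mono) auto
    also have "\<dots> = 2 * ?V * (1 / 2) ^ k" by (simp add: power2_eq_square power_one_over)
    finally show "ennreal (2 ^ (k + 1)) * emeasure lborel (cball y (1 / 2 ^ k))
      \<le> ennreal (2 * ?V * (1 / 2) ^ k)"
      by (simp add: emeasure_cball ennreal_mult[symmetric] ennreal_leI)
  qed auto
  also have "\<dots> = ennreal (\<Sum>k. 2 * ?V * (1 / 2) ^ k)"
    by (intro suminf_ennreal2) (auto intro!: summable_mult summable_geometric)
  also have "(\<Sum>k. 2 * ?V * (1 / 2) ^ k) = 4 * ?V"
    by (subst suminf_mult) (auto simp: suminf_geometric intro!: summable_geometric)
  finally show ?thesis by (simp add: add_left_mono)
qed

text \<open>Equality in Cauchy-Schwarz forces \<open>h\<close> onto the line spanned by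
  \<open>v\<close>, which is Lebesgue-null in dimension at least two.\<close>

lemma AE_lborel_not_collinear:
  fixes v :: "'a::euclidean_space"
  assumes "v \<noteq> 0" and dim: "DIM('a) \<ge> 2"
  shows "AE h in lborel. \<bar>v \<bullet> h\<bar> < norm v * norm h"
proof -
  have "dim (span {v}) \<le> 1" using dim_le_card'[of "{v}"] by (simp add: dim_span)
  then have "negligible (span {v})" using dim by (intro negligible_lowdim) auto
  then have null: "span {v} \<in> null_sets lborel"
    by (simp add: negligible_iff_null_sets null_sets_completion_iff borel_closed closed_span)
  have "h \<in> span {v}" if "\<not> \<bar>v \<bullet> h\<bar> < norm v * norm h" for h
  proof -
    have "\<bar>v \<bullet> h\<bar> = norm v * norm h" using that Cauchy_Schwarz_ineq2[of v h] by simp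
    then have "norm v *\<^sub>R h = norm h *\<^sub>R v \<or> norm v *\<^sub>R h = - norm h *\<^sub>R v"
      by (simp add: norm_cauchy_schwarz_abs_eq)
    then have "norm v *\<^sub>R h \<in> span {v}" by (metis span_base span_scale singletonI)
    then have "(1 / norm v) *\<^sub>R (norm v *\<^sub>R h) \<in> span {v}" by (rule span_scale)
    then show ?thesis using assms(1) by simp
  qed
  then show ?thesis by (intro AE_I'[OF null]) auto
qed

text \<open>Fubini for null sets: the exceptional directions are null for almost every outcome, so
  the exceptional outcomes are null for almost every direction.\<close>

lemma (in prob_space) AE_direction_not_collinear:
  fixes V :: "'a \<Rightarrow> 'b::euclidean_space"
  assumes V [measurable]: "V \<in> borel_measurable M" and nz: "AE \<omega> in M. V \<omega> \<noteq> 0"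
    and dim: "DIM('b) \<ge> 2"
  shows "AE h in lborel. AE \<omega> in M. \<bar>V \<omega> \<bullet> h\<bar> < norm (V \<omega>) * norm h"
proof -
  interpret pair_sigma_finite M "lborel :: 'b measure" ..
  have "AE \<omega> in M. AE h in lborel. \<bar>V \<omega> \<bullet> h\<bar> < norm (V \<omega>) * norm h"
    using nz by eventually_elim (rule AE_lborel_not_collinear[OF _ dim])
  then show ?thesis by (subst (asm) AE_commute) measurable
qed

text \<open>For fixed \<open>t > 0\<close>, Tonelli and the pole-independent bound make the mean
  inverse distance integrable over the ball of directions, hence finite for almost every
  direction.\<close>

lemma (in prob_space) AE_direction_inverse_norm_finite:
  fixes V :: "'a \<Rightarrow> 'b::euclidean_space"
  assumes V [measurable]: "V \<in> borel_measurable M" and dim: "DIM('b) \<ge> 2"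
  shows "AE h in lborel. h \<in> cball 0 R \<longrightarrow>
    (AE t in lborel. 0 < t \<longrightarrow> (\<integral>\<^sup>+\<omega>. ennreal (1 / norm (V \<omega> - t *\<^sub>R h)) \<partial>M) < \<infinity>)"
proof -
  interpret pair_sigma_finite M "lborel :: 'b measure" ..
  let ?C = "emeasure lborel (cball (0::'b) R) + ennreal (4 * unit_ball_vol (real DIM('b)))"
  define F where "F t h = (\<integral>\<^sup>+\<omega>. ennreal (1 / norm (V \<omega> - t *\<^sub>R h)) \<partial>M)" for t h
  have "AE h in lborel. h \<in> cball 0 R \<longrightarrow> F t h < \<infinity>" if t: "0 < t" for t
  proof -
    have inner: "(\<integral>\<^sup>+h. ennreal (1 / norm (v - t *\<^sub>R h)) * indicator (cball 0 R) h \<partial>lborel)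
      \<le> ennreal (1 / t) * ?C" for v :: 'b
    proof -
      \<comment> \<open>Factoring out \<open>t\<close> moves the pole to
        \<open>(1 / t) *\<^sub>R v\<close> and costs a factor \<open>1 / t\<close>.\<close>
      have eq: "1 / norm (v - t *\<^sub>R h) = (1 / t) * (1 / norm (h - (1 / t) *\<^sub>R v))" for h
      proof -
        have "v - t *\<^sub>R h = - (t *\<^sub>R (h - (1 / t) *\<^sub>R v))"
          using t by (simp add: algebra_simps)
        then have "norm (v - t *\<^sub>R h) = t * norm (h - (1 / t) *\<^sub>R v)"
          using t by (simp only: norm_minus_cancel norm_scaleR abs_of_pos)
        then show ?thesis by simp
      qed
      have "(\<integral>\<^sup>+h. ennreal (1 / norm (v - t *\<^sub>R h)) * indicator (cball 0 R) h \<partial>lborel)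
        = (\<integral>\<^sup>+h. ennreal (1 / t) * (ennreal (1 / norm (h - (1 / t) *\<^sub>R v)) * indicator (cball 0 R) h) \<partial>lborel)"
      proof (rule nn_integral_cong)
        fix h
        have "ennreal (1 / norm (v - t *\<^sub>R h)) = ennreal (1 / t) * ennreal (1 / norm (h - (1 / t) *\<^sub>R v))"
          unfolding eq by (rule ennreal_mult) (use t in auto)
        then show "ennreal (1 / norm (v - t *\<^sub>R h)) * indicator (cball 0 R) h
          = ennreal (1 / t) * (ennreal (1 / norm (h - (1 / t) *\<^sub>R v)) * indicator (cball 0 R) h)"
          by (simp only: mult.assoc)
      qed
      also have "\<dots> = ennreal (1 / t) * (\<integral>\<^sup>+h. ennreal (1 / norm (h - (1 / t) *\<^sub>R v)) * indicator (cball 0 R) h \<partial>lborel)"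
        by (intro nn_integral_cmult) measurable
      also have "\<dots> \<le> ennreal (1 / t) * ?C"
        by (intro mult_left_mono nn_integral_inverse_norm_le dim) auto
      finally show ?thesis .
    qed
    have "(\<integral>\<^sup>+h. F t h * indicator (cball 0 R) h \<partial>lborel)
      = (\<integral>\<^sup>+h. \<integral>\<^sup>+\<omega>. ennreal (1 / norm (V \<omega> - t *\<^sub>R h)) * indicator (cball 0 R) h \<partial>M \<partial>lborel)"
      unfolding F_def by (intro nn_integral_cong nn_integral_multc[symmetric]; measurable)
    also have "\<dots> = (\<integral>\<^sup>+\<omega>. \<integral>\<^sup>+h. ennreal (1 / norm (V \<omega> - t *\<^sub>R h)) * indicator (cball 0 R) h \<partial>lborel \<partial>M)"
      by (rule Fubini') measurable
    also have "\<dots> \<le> (\<integral>\<^sup>+\<omega>. ennreal (1 / t) * ?C \<partial>M)"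
      by (intro nn_integral_mono inner)
    also have "\<dots> < \<infinity>"
      using emeasure_bounded_finite[OF bounded_cball, of "0::'b" R]
      by (simp add: emeasure_space_1 ennreal_mult_less_top)
    finally have "(\<integral>\<^sup>+h. F t h * indicator (cball 0 R) h \<partial>lborel) \<noteq> \<infinity>" by simp
    then have "AE h in lborel. F t h * indicator (cball 0 R) h \<noteq> \<infinity>"
      by (rule nn_integral_PInf_AE[rotated]) (unfold F_def, measurable)
    then show ?thesis by eventually_elim (auto simp: less_top)
  qed
  then have "AE h in lborel. 0 < t \<longrightarrow> h \<in> cball 0 R \<longrightarrow> F t h < \<infinity>" for t
    by (cases "0 < t") auto
  \<comment> \<open>The null set of bad directions depends on \<open>t\<close>. Exchanging the two
    quantifiers gives one null set of directions, outside which almost every \<open>t\<close> is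
    good.\<close>
  then have "AE t in lborel. AE h in lborel. 0 < t \<longrightarrow> h \<in> cball 0 R \<longrightarrow> F t h < \<infinity>"
    by (rule AE_I2)
  then have "AE h in lborel. AE t in lborel. 0 < t \<longrightarrow> h \<in> cball 0 R \<longrightarrow> F t h < \<infinity>"
    by (subst (asm) lborel_pair.AE_commute) (unfold F_def, measurable)
  then show ?thesis unfolding F_def by eventually_elim auto
qed

section \<open>Second-order expansion of the norm along a segment\<close>

text \<open>The quadratic form at \<open>h\<close> of the Hessian of the norm at \<open>v\<close>;
  division by zero gives it the value 0 at \<open>v = 0\<close>.\<close>

definition norm_hess :: "'a::real_inner \<Rightarrow> 'a \<Rightarrow> real" where
  "norm_hess v h = (1 / norm v) * ((norm h)\<^sup>2 - (1 / (norm v)\<^sup>2) * (v \<bullet> h)\<^sup>2)"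

lemma norm_hess_nonneg: "0 \<le> norm_hess v h"
proof (cases "v = 0")
  case False
  have "(v \<bullet> h)\<^sup>2 \<le> (norm v)\<^sup>2 * (norm h)\<^sup>2"
    using Cauchy_Schwarz_ineq[of v h] by (simp add: power2_norm_eq_inner)
  then show ?thesis using False by (simp add: norm_hess_def field_simps)
qed (simp add: norm_hess_def)

lemma norm_hess_uminus [simp]: "norm_hess (- v) h = norm_hess v h"
  by (simp add: norm_hess_def)

lemma measurable_norm_hess [measurable (raw)]:
  fixes f g :: "'a \<Rightarrow> 'b::euclidean_space"
  assumes [measurable]: "f \<in> borel_measurable M" "g \<in> borel_measurable M"
  shows "(\<lambda>x. norm_hess (f x) (g x)) \<in> borel_measurable M"
  unfolding norm_hess_def by measurable

text \<open>
  With \<open>\<phi> t = norm (t *\<^sub>R h - v)\<close>, this is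
  \<open>w0 * (\<phi>' 1 - \<phi>' 0) + w1 * (\<phi> 1 - \<phi> 0 - \<phi>' 0)\<close>, the combination of first-order increments of the norm
  that equals the integral of \<open>\<phi>''\<close> over \<open>{0..1}\<close> against the weight \<open>w0 + w1 * (1 - t)\<close>.
\<close>
definition norm_gain :: "real \<Rightarrow> real \<Rightarrow> 'a::real_inner \<Rightarrow> 'a \<Rightarrow> real" where
  "norm_gain w0 w1 v h =
     w0 * ((sgn (h - v) + sgn v) \<bullet> h) + w1 * (norm (h - v) - norm v + sgn v \<bullet> h)"

lemma sgn_inner_self: "sgn v \<bullet> v = norm v"
  by (cases "v = 0") (simp_all add: sgn_div_norm power2_norm_eq_inner[symmetric] power2_eq_square)

lemma sgn_inner_ge: "- norm w \<le> sgn v \<bullet> w"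
proof -
  have "\<bar>sgn v \<bullet> w\<bar> \<le> norm (sgn v) * norm w" by (rule Cauchy_Schwarz_ineq2)
  also have "\<dots> \<le> 1 * norm w" by (intro mult_right_mono) (auto simp: norm_sgn)
  finally show ?thesis by simp
qed

lemma sgn_inner_le: "sgn v \<bullet> w \<le> norm w"
  using sgn_inner_ge[of w "- v"] by (simp add: sgn_minus)

text \<open>Convexity: \<open>- sgn v\<close> is a subgradient of the norm at \<open>- v\<close>,
  including \<open>v = 0\<close>, where \<open>sgn 0 = 0\<close>.\<close>

lemma norm_first_order_nonneg: "0 \<le> norm (h - v) - norm v + sgn v \<bullet> h"
proof -
  have "sgn v \<bullet> h = sgn v \<bullet> (h - v) + norm v" by (simp add: inner_diff_right sgn_inner_self)
  then show ?thesis using sgn_inner_ge[of "h - v" v] by simp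
qed

text \<open>Monotonicity of these subgradients between the points \<open>- v\<close> and
  \<open>h - v\<close>.\<close>

lemma norm_gradient_monotone: "0 \<le> (sgn (h - v) + sgn v) \<bullet> h"
proof -
  have "(sgn (h - v) + sgn v) \<bullet> h
    = (sgn (h - v) \<bullet> (h - v) + sgn v \<bullet> (h - v)) + (sgn (h - v) \<bullet> v + sgn v \<bullet> v)"
    by (simp add: inner_diff_right inner_add_left)
  then show ?thesis
    using sgn_inner_ge[of "h - v" v] sgn_inner_ge[of v "h - v"] by (simp add: sgn_inner_self)
qed

text \<open>Both brackets of \<open>norm_gain\<close> are nonnegative for all \<open>v\<close> and
  \<open>h\<close>, so a weight of either sign may be replaced by an upper bound. This is needed
  later, where the weight \<open>a - \<rho>\<close> can be negative.\<close>

lemma norm_gain_mono: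
  "w0 \<le> w0' \<Longrightarrow> w1 \<le> w1' \<Longrightarrow> norm_gain w0 w1 v h \<le> norm_gain w0' w1' v h"
  unfolding norm_gain_def
  by (intro add_mono mult_right_mono norm_first_order_nonneg norm_gradient_monotone)

lemma norm_gain_nonneg: "0 \<le> w0 \<Longrightarrow> 0 \<le> w1 \<Longrightarrow> 0 \<le> norm_gain w0 w1 v h"
  unfolding norm_gain_def by (simp add: norm_first_order_nonneg norm_gradient_monotone)

lemma abs_norm_gain_le:
  "\<bar>norm_gain w0 w1 v h\<bar> \<le> 2 * (\<bar>w0\<bar> + \<bar>w1\<bar>) * norm h"
proof -
  have "norm_gain w0 w1 v h \<le> norm_gain \<bar>w0\<bar> \<bar>w1\<bar> v h"
    and "norm_gain (- \<bar>w0\<bar>) (- \<bar>w1\<bar>) v h \<le> norm_gain w0 w1 v h"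
    by (intro norm_gain_mono; simp)+
  moreover have "norm_gain (- \<bar>w0\<bar>) (- \<bar>w1\<bar>) v h = - norm_gain \<bar>w0\<bar> \<bar>w1\<bar> v h"
    by (simp add: norm_gain_def)
  moreover have "norm_gain \<bar>w0\<bar> \<bar>w1\<bar> v h \<le> \<bar>w0\<bar> * (2 * norm h) + \<bar>w1\<bar> * (2 * norm h)"
    unfolding norm_gain_def
  proof (intro add_mono mult_left_mono)
    show "(sgn (h - v) + sgn v) \<bullet> h \<le> 2 * norm h"
      using sgn_inner_le[of "h - v" h] sgn_inner_le[of v h] by (simp add: inner_add_left)
    show "norm (h - v) - norm v + sgn v \<bullet> h \<le> 2 * norm h"
      using sgn_inner_le[of v h] norm_triangle_ineq4[of h v] by simp
  qed auto
  ultimately show ?thesis by (simp add: algebra_simps abs_le_iff)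
qed

lemma measurable_norm_gain [measurable (raw)]:
  fixes f g :: "'a \<Rightarrow> 'b::euclidean_space"
  assumes [measurable]: "f \<in> borel_measurable M" "g \<in> borel_measurable M"
  shows "(\<lambda>x. norm_gain w0 w1 (f x) (g x)) \<in> borel_measurable M"
  unfolding norm_gain_def by measurable

text \<open>With \<open>p\<close> the norm along the segment and \<open>q / p\<close> its
  derivative, \<open>G\<close> is a primitive of the weighted second derivative: the two first-order
  terms from differentiating \<open>(1 - t) * (q t / p t) + p t\<close> cancel. Non-collinearity
  keeps the line off the origin, so \<open>p\<close> is smooth.\<close>

lemma nn_integral_segment_norm_hess:
  fixes v h :: "'a::euclidean_space"
  assumes nc: "\<bar>v \<bullet> h\<bar> < norm v * norm h" and w: "0 \<le> w0" "0 \<le> w1"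
  shows "(\<integral>\<^sup>+t. ennreal ((w0 + w1 * (1 - t)) * norm_hess (v - t *\<^sub>R h) h) * indicator {0..1} t \<partial>lborel)
    = ennreal (norm_gain w0 w1 v h)"
proof -
  define p where "p t = norm (t *\<^sub>R h - v)" for t
  define q where "q t = (t *\<^sub>R h - v) \<bullet> h" for t
  define G where "G t = w0 * (q t / p t) + w1 * ((1 - t) * (q t / p t) + p t)" for t
  have nz: "t *\<^sub>R h - v \<noteq> 0" for t
  proof
    assume "t *\<^sub>R h - v = 0"
    then have "v = t *\<^sub>R h" by simp
    then have "\<bar>v \<bullet> h\<bar> = norm v * norm h"
      by (simp add: abs_mult power2_norm_eq_inner[symmetric] power2_eq_square)
    then show False using nc by simp
  qed
  then have pnz: "p t \<noteq> 0" for t by (simp add: p_def)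
  have dp: "(p has_field_derivative (q t / p t)) (at t)" for t
  proof -
    have d1: "((\<lambda>t. t *\<^sub>R h - v) has_derivative (\<lambda>s. s *\<^sub>R h)) (at t)"
      by (auto intro!: derivative_eq_intros)
    have d2: "(norm has_derivative (\<lambda>k. k \<bullet> sgn (t *\<^sub>R h - v))) (at (t *\<^sub>R h - v))"
      using nz[of t] by (rule has_derivative_norm)
    have "(p has_derivative (\<lambda>s. (s *\<^sub>R h) \<bullet> sgn (t *\<^sub>R h - v))) (at t)"
      unfolding p_def using has_derivative_compose[OF d1 d2] .
    moreover have "(\<lambda>s. (s *\<^sub>R h) \<bullet> sgn (t *\<^sub>R h - v)) = (*) (q t / p t)"
      by (simp add: fun_eq_iff q_def p_def sgn_div_norm inner_commute divide_inverse ac_simps)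
    ultimately show ?thesis by (simp add: has_field_derivative_def)
  qed
  have dq: "(q has_field_derivative (norm h)\<^sup>2) (at t)" for t
  proof -
    have "q = (\<lambda>t. t * (h \<bullet> h) - v \<bullet> h)" by (simp add: fun_eq_iff q_def inner_diff_left)
    then show ?thesis
      by (auto intro!: derivative_eq_intros simp: power2_norm_eq_inner)
  qed
  have dqp: "((\<lambda>t. q t / p t) has_field_derivative norm_hess (v - t *\<^sub>R h) h) (at t)" for t
  proof -
    have "norm_hess (v - t *\<^sub>R h) h = norm_hess (t *\<^sub>R h - v) h"
      using norm_hess_uminus[of "t *\<^sub>R h - v" h] by simp
    also have "\<dots> = ((norm h)\<^sup>2 * p t - q t * (q t / p t)) / (p t * p t)"
      using pnz[of t] unfolding norm_hess_def p_def[symmetric] q_def[symmetric]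
      by (simp add: field_simps power2_eq_square)
    finally show ?thesis using DERIV_divide[OF dq dp pnz] by simp
  qed
  have dG: "(G has_field_derivative (w0 + w1 * (1 - t)) * norm_hess (v - t *\<^sub>R h) h) (at t)" for t
    unfolding G_def
    by (rule derivative_eq_intros dqp dp refl)+ (simp add: algebra_simps)
  have "(\<integral>\<^sup>+t. ennreal ((w0 + w1 * (1 - t)) * norm_hess (v - t *\<^sub>R h) h) * indicator {0..1} t \<partial>lborel)
    = G 1 - G 0"
    by (rule nn_integral_FTC_Icc) (use dG w in \<open>auto intro!: mult_nonneg_nonneg add_nonneg_nonneg norm_hess_nonneg\<close>)
  also have "G 1 - G 0 = norm_gain w0 w1 v h"
  proof -
    have "q 1 / p 1 = sgn (h - v) \<bullet> h" "q 0 / p 0 = - (sgn v \<bullet> h)"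
      by (simp_all add: p_def q_def sgn_div_norm divide_inverse mult.commute)
    then show ?thesis by (simp add: G_def norm_gain_def p_def algebra_simps)
  qed
  finally show ?thesis .
qed

section \<open>The Hessian matrix of the norm and its mean \<open>Gamma_mat\<close>\<close>

lemma bounded_linear_matrix_form: "bounded_linear (\<lambda>A :: real^'n^'n. h \<bullet> (A *v h))"
  unfolding linear_conv_bounded_linear[symmetric]
  by (rule linearI)
    (simp_all add: matrix_vector_mult_add_rdistrib inner_add_right scaleR_matrix_vector_assoc[symmetric])

definition norm_hess_mat :: "real^'n \<Rightarrow> real^'n^'n" where
  "norm_hess_mat v = (1 / norm v) *\<^sub>R (mat 1 - (1 / (norm v)\<^sup>2) *\<^sub>R outer v v)"

lemma Gamma_mat_eq: "Gamma_mat M X z = (\<integral>\<omega>. norm_hess_mat (X \<omega> - z) \<partial>M)"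
  by (simp add: Gamma_mat_def norm_hess_mat_def)

lemma norm_hess_mat_form: "h \<bullet> (norm_hess_mat v *v h) = norm_hess v h"
  by (simp add: norm_hess_mat_def norm_hess_def matrix_vector_mult_diff_rdistrib outer_matrix_vector
      scaleR_matrix_vector_assoc[symmetric] inner_diff_right dot_square_norm inner_commute power2_eq_square)

lemma transpose_norm_hess_mat: "transpose (norm_hess_mat v) = norm_hess_mat v"
  by (simp add: norm_hess_mat_def transpose_def vec_eq_iff outer_def mat_def mult.commute)

lemma norm_norm_hess_mat_le: "norm (norm_hess_mat (v :: real^'n)) \<le> (norm (mat 1 :: real^'n^'n) + 1) * (1 / norm v)"
proof -
  have "norm (mat 1 - (1 / (norm v)\<^sup>2) *\<^sub>R outer v v)
    \<le> norm (mat 1 :: real^'n^'n) + norm ((1 / (norm v)\<^sup>2) *\<^sub>R outer v v)"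
    by (rule norm_triangle_ineq4)
  also have "norm ((1 / (norm v)\<^sup>2) *\<^sub>R outer v v) \<le> 1"
    by (simp add: norm_outer power2_eq_square)
  finally have "(1 / norm v) * norm (mat 1 - (1 / (norm v)\<^sup>2) *\<^sub>R outer v v)
    \<le> (1 / norm v) * (norm (mat 1 :: real^'n^'n) + 1)"
    by (intro mult_left_mono) auto
  then show ?thesis by (simp add: norm_hess_mat_def mult.commute)
qed

lemma measurable_norm_hess_mat [measurable]: "norm_hess_mat \<in> borel_measurable borel"
proof -
  have "continuous_on UNIV (\<lambda>v :: real^'n. outer v v)"
    unfolding outer_def by (intro continuous_intros)
  then have [measurable]: "(\<lambda>v :: real^'n. outer v v) \<in> borel_measurable borel"
    by (rule borel_measurable_continuous_onI)
  show ?thesis unfolding norm_hess_mat_def[abs_def] by measurable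
qed

text \<open>No integrability is assumed: if the integrand is not integrable, the Bochner integral is
  the zero matrix, which is symmetric too.\<close>

lemma transpose_Gamma_mat: "transpose (Gamma_mat M X z) = Gamma_mat M X z"
proof (cases "integrable M (\<lambda>\<omega>. norm_hess_mat (X \<omega> - z))")
  case True
  have bl: "bounded_linear (transpose :: real^'n^'n \<Rightarrow> real^'n^'n)"
    unfolding linear_conv_bounded_linear[symmetric]
    by (rule linearI) (simp_all add: transpose_def vec_eq_iff)
  have "(\<integral>\<omega>. transpose (norm_hess_mat (X \<omega> - z)) \<partial>M) = transpose (Gamma_mat M X z)"
    unfolding Gamma_mat_eq by (rule integral_bounded_linear[OF bl True])
  then show ?thesis by (simp add: transpose_norm_hess_mat Gamma_mat_eq)
next
  case False
  then show ?thesis by (simp add: Gamma_mat_eq not_integrable_integral_eq transpose_def vec_eq_iff)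
qed

lemma Gamma_mat_form:
  assumes "integrable M (\<lambda>\<omega>. norm_hess_mat (X \<omega> - z))"
  shows "integrable M (\<lambda>\<omega>. norm_hess (X \<omega> - z) h)"
    and "h \<bullet> (Gamma_mat M X z *v h) = (\<integral>\<omega>. norm_hess (X \<omega> - z) h \<partial>M)"
  using integrable_bounded_linear[OF bounded_linear_matrix_form assms, of h]
    integral_bounded_linear[OF bounded_linear_matrix_form assms, of h]
  by (simp_all add: norm_hess_mat_form Gamma_mat_eq)

text \<open>Test the Rayleigh bound with any unit vector; the form is nonnegative, being 0 in the
  non-integrable case.\<close>

lemma lambda_max_Gamma_mat_nonneg:
  fixes X :: "'w \<Rightarrow> real^'n"
  shows "0 \<le> lambda_max (Gamma_mat M X z)"
proof -
  define h :: "real^'n" where "h = axis undefined 1"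
  have h: "norm h = 1" by (simp add: h_def norm_axis_1)
  have "0 \<le> h \<bullet> (Gamma_mat M X z *v h)"
  proof (cases "integrable M (\<lambda>\<omega>. norm_hess_mat (X \<omega> - z))")
    case True
    then show ?thesis by (simp add: Gamma_mat_form integral_nonneg_AE norm_hess_nonneg)
  next
    case False
    then show ?thesis by (simp add: Gamma_mat_eq not_integrable_integral_eq)
  qed
  also have "\<dots> \<le> lambda_max (Gamma_mat M X z)"
    using rayleigh_le_lambda_max[OF transpose_Gamma_mat, of h M X z] h by simp
  finally show ?thesis .
qed

section \<open>Strong monotonicity of the mean gradient\<close>

lemma (in prob_space) integrable_norm_gain:
  fixes V :: "'a \<Rightarrow> 'b::euclidean_space"
  assumes [measurable]: "V \<in> borel_measurable M"
  shows "integrable M (\<lambda>\<omega>. norm_gain w0 w1 (V \<omega>) h)"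
proof (rule integrable_const_bound)
  show "AE \<omega> in M. norm (norm_gain w0 w1 (V \<omega>) h) \<le> 2 * (\<bar>w0\<bar> + \<bar>w1\<bar>) * norm h"
    unfolding real_norm_def by (intro AE_I2 abs_norm_gain_le)
qed measurable

text \<open>Tonelli turns the expected gain into an integral over the segment of the form of
  \<open>Gamma_mat M V (t *\<^sub>R h)\<close>, and the Rayleigh bound controls this form by
  \<open>L\<close>. The two exceptional null sets of directions are those of the preceding
  section.\<close>

lemma (in prob_space) AE_expectation_norm_gain_le:
  fixes V :: "'a \<Rightarrow> real^'n"
  assumes V [measurable]: "V \<in> borel_measurable M" and nz: "AE \<omega> in M. V \<omega> \<noteq> 0"
    and card: "CARD('n) \<ge> 2"
    and L: "\<And>z. z \<in> cball 0 R \<Longrightarrow> lambda_max (Gamma_mat M V z) \<le> L"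
    and w: "0 \<le> w0" "0 \<le> w1"
  shows "AE h in lborel. h \<in> cball 0 R \<longrightarrow>
    (\<integral>\<omega>. norm_gain w0 w1 (V \<omega>) h \<partial>M) \<le> (w0 + w1 / 2) * (L * (norm h)\<^sup>2)"
proof -
  interpret pair_sigma_finite M "lborel :: real measure" ..
  have dim: "DIM(real^'n) \<ge> 2" using card by simp
  show ?thesis
    using AE_direction_not_collinear[OF V nz dim] AE_direction_inverse_norm_finite[OF V dim, of R]
  proof eventually_elim
    case (elim h)
    show ?case
    proof
      assume h: "h \<in> cball 0 R"
      \<comment> \<open>Nonnegativity of \<open>L\<close> keeps the real bounds meaningful after the
        passage to \<open>ennreal\<close>.\<close>
      have L0: "0 \<le> L"
      proof -
        have "norm h \<le> R" using h by simp
        then have "0 \<le> R" using norm_ge_zero[of h] by linarith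
        then show ?thesis using L[of 0] lambda_max_Gamma_mat_nonneg[of M V 0] by simp
      qed
      have fin: "AE t in lborel. 0 < t \<longrightarrow> (\<integral>\<^sup>+\<omega>. ennreal (1 / norm (V \<omega> - t *\<^sub>R h)) \<partial>M) < \<infinity>"
        using elim(2) h by simp
      let ?w = "\<lambda>t. w0 + w1 * (1 - t)"
      have int: "integrable M (\<lambda>\<omega>. norm_gain w0 w1 (V \<omega>) h)"
        by (rule integrable_norm_gain) measurable
      have "ennreal (\<integral>\<omega>. norm_gain w0 w1 (V \<omega>) h \<partial>M) = (\<integral>\<^sup>+\<omega>. ennreal (norm_gain w0 w1 (V \<omega>) h) \<partial>M)"
        by (rule nn_integral_eq_integral[symmetric, OF int]) (simp add: norm_gain_nonneg w)
      also have "\<dots> = (\<integral>\<^sup>+\<omega>. \<integral>\<^sup>+t. ennreal (?w t * norm_hess (V \<omega> - t *\<^sub>R h) h) * indicator {0..1} t \<partial>lborel \<partial>M)"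
        by (rule nn_integral_cong_AE) (use elim(1) in \<open>eventually_elim, simp add: nn_integral_segment_norm_hess w\<close>)
      also have "\<dots> = (\<integral>\<^sup>+t. \<integral>\<^sup>+\<omega>. ennreal (?w t * norm_hess (V \<omega> - t *\<^sub>R h) h) * indicator {0..1} t \<partial>M \<partial>lborel)"
        by (rule Fubini'[symmetric]) measurable
      also have "\<dots> \<le> (\<integral>\<^sup>+t. ennreal (?w t * (L * (norm h)\<^sup>2)) * indicator {0..1} t \<partial>lborel)"
      proof (rule nn_integral_mono_AE)
        show "AE t in lborel. (\<integral>\<^sup>+\<omega>. ennreal (?w t * norm_hess (V \<omega> - t *\<^sub>R h) h) * indicator {0..1} t \<partial>M)
          \<le> ennreal (?w t * (L * (norm h)\<^sup>2)) * indicator {0..1} t"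
          \<comment> \<open>The endpoint \<open>t = 0\<close> is discarded because
            \<open>fin\<close> speaks only of positive \<open>t\<close>.\<close>
          using fin AE_lborel_singleton[of 0]
        proof eventually_elim
          case (elim t)
          show ?case
          proof (cases "t \<in> {0..1}")
            case True
            then have t: "0 < t" "t \<le> 1" using elim(2) by auto
            have "integrable M (\<lambda>\<omega>. 1 / norm (V \<omega> - t *\<^sub>R h))"
              using elim(1) t by (intro integrableI_bounded) auto
            then have "integrable M (\<lambda>\<omega>. (norm (mat 1 :: real^'n^'n) + 1) * (1 / norm (V \<omega> - t *\<^sub>R h)))"
              by (rule integrable_mult_right)
            then have im: "integrable M (\<lambda>\<omega>. norm_hess_mat (V \<omega> - t *\<^sub>R h))"
              by (rule Bochner_Integration.integrable_bound)
                (use norm_norm_hess_mat_le in \<open>auto intro: order_trans\<close>)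
            note form = Gamma_mat_form[OF im, of h]
            have "norm (t *\<^sub>R h) \<le> 1 * norm h"
              unfolding norm_scaleR using t by (intro mult_right_mono) auto
            then have th: "t *\<^sub>R h \<in> cball 0 R" using h by simp
            have wt: "0 \<le> ?w t" using w t by simp
            have "(\<integral>\<^sup>+\<omega>. ennreal (?w t * norm_hess (V \<omega> - t *\<^sub>R h) h) \<partial>M)
              = ennreal (\<integral>\<omega>. ?w t * norm_hess (V \<omega> - t *\<^sub>R h) h \<partial>M)"
              by (rule nn_integral_eq_integral)
                (use form wt in \<open>auto intro!: mult_nonneg_nonneg norm_hess_nonneg simp del: distrib_left_numeral\<close>)
            also have "\<dots> = ennreal (?w t * (h \<bullet> (Gamma_mat M V (t *\<^sub>R h) *v h)))"
              unfolding form(2) by simp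
            also have "\<dots> \<le> ennreal (?w t * (L * (norm h)\<^sup>2))"
            proof (intro ennreal_leI mult_left_mono wt)
              have "h \<bullet> (Gamma_mat M V (t *\<^sub>R h) *v h) \<le> lambda_max (Gamma_mat M V (t *\<^sub>R h)) * (norm h)\<^sup>2"
                by (rule rayleigh_le_lambda_max[OF transpose_Gamma_mat])
              also have "\<dots> \<le> L * (norm h)\<^sup>2" by (intro mult_right_mono L th) simp
              finally show "h \<bullet> (Gamma_mat M V (t *\<^sub>R h) *v h) \<le> L * (norm h)\<^sup>2" .
            qed
            finally show ?thesis using True by simp
          qed simp
        qed
      qed
      also have "\<dots> = ennreal ((w0 * 1 + w1 * (1 - 1 / 2)) * (L * (norm h)\<^sup>2) - 0)"
      proof -
        define F where "F t = (w0 * t + w1 * (t - t\<^sup>2 / 2)) * (L * (norm h)\<^sup>2)" for t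
        have "(\<integral>\<^sup>+t. ennreal (?w t * (L * (norm h)\<^sup>2)) * indicator {0..1} t \<partial>lborel) = F 1 - F 0"
        proof (rule nn_integral_FTC_Icc)
          show "(F has_field_derivative ?w t * (L * (norm h)\<^sup>2)) (at t)" for t
            unfolding F_def by (rule derivative_eq_intros refl | simp)+ 
        qed (use w L0 in auto)
        then show ?thesis by (simp add: F_def)
      qed
      finally have le: "ennreal (\<integral>\<omega>. norm_gain w0 w1 (V \<omega>) h \<partial>M) \<le> ennreal ((w0 + w1 / 2) * (L * (norm h)\<^sup>2))"
        by simp
      have "0 \<le> (w0 + w1 / 2) * (L * (norm h)\<^sup>2)" using w L0 by simp
      then show "(\<integral>\<omega>. norm_gain w0 w1 (V \<omega>) h \<partial>M) \<le> (w0 + w1 / 2) * (L * (norm h)\<^sup>2)"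
        using le by (simp add: ennreal_le_iff)
    qed
  qed
qed

text \<open>A nonempty open set is not negligible, so a property that holds almost everywhere holds
  on a dense set.\<close>

lemma AE_lborel_open_obtain:
  fixes S :: "'a::euclidean_space set"
  assumes "AE h in lborel. P h" and "open S" "S \<noteq> {}"
  obtains h where "h \<in> S" "P h"
proof (rule ccontr)
  assume "\<not> thesis"
  then have "S \<subseteq> {h. \<not> P h}" using that by auto
  moreover obtain N where N: "{h \<in> space lborel. \<not> P h} \<subseteq> N" "N \<in> null_sets lborel"
    using assms(1) by (auto elim!: AE_E simp: null_sets_def)
  ultimately have "S \<subseteq> N" by auto
  moreover have "negligible N" using N(2) by (simp add: negligible_iff_null_sets null_sets_completionI)
  ultimately have "negligible S" using negligible_subset by blast
  then show False using open_not_negligible assms(2,3) by blast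
qed

text \<open>Removes the exceptional directions: the bound holds on a dense subset of the ball, and
  both sides are continuous in \<open>h\<close> there because \<open>V\<close> charges no point of
  the closed ball.\<close>

lemma (in prob_space) expectation_norm_gain_le:
  fixes V :: "'a \<Rightarrow> real^'n"
  assumes V [measurable]: "V \<in> borel_measurable M"
    and nz: "\<And>z. z \<in> cball 0 R \<Longrightarrow> AE \<omega> in M. V \<omega> \<noteq> z"
    and card: "CARD('n) \<ge> 2" and R: "R > 0"
    and L: "\<And>z. z \<in> cball 0 R \<Longrightarrow> lambda_max (Gamma_mat M V z) \<le> L"
    and w: "0 \<le> w0" "0 \<le> w1" and h: "h \<in> cball 0 R"
  shows "(\<integral>\<omega>. norm_gain w0 w1 (V \<omega>) h \<partial>M) \<le> (w0 + w1 / 2) * (L * (norm h)\<^sup>2)"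
proof -
  \<comment> \<open>The open ball is used so that its intersection with a neighbourhood is open; its
    closure still contains a direction \<open>h\<close> of norm \<open>R\<close>.\<close>
  define T where "T = {h \<in> ball 0 R. (\<integral>\<omega>. norm_gain w0 w1 (V \<omega>) h \<partial>M) \<le> (w0 + w1 / 2) * (L * (norm h)\<^sup>2)}"
  have ae: "AE h in lborel. h \<in> cball 0 R \<longrightarrow>
    (\<integral>\<omega>. norm_gain w0 w1 (V \<omega>) h \<partial>M) \<le> (w0 + w1 / 2) * (L * (norm h)\<^sup>2)"
    by (rule AE_expectation_norm_gain_le[OF V nz card L w]) (use R in auto)
  have "h \<in> closure T"
    unfolding closure_iff_nhds_not_empty
  proof (intro allI impI)
    fix A S assume "S \<subseteq> A" "open S" "h \<in> S"
    have "h \<in> closure (ball 0 R)" using h R by (simp add: closure_ball)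
    then have "S \<inter> ball 0 R \<noteq> {}"
      using \<open>open S\<close> \<open>h \<in> S\<close> unfolding closure_iff_nhds_not_empty by (metis inf_commute order_refl)
    then obtain k where k: "k \<in> S \<inter> ball 0 R" and "k \<in> cball 0 R \<longrightarrow>
      (\<integral>\<omega>. norm_gain w0 w1 (V \<omega>) k \<partial>M) \<le> (w0 + w1 / 2) * (L * (norm k)\<^sup>2)"
      using AE_lborel_open_obtain[OF ae, of "S \<inter> ball 0 R"] \<open>open S\<close> by blast
    then have "k \<in> T" by (auto simp: T_def)
    then show "T \<inter> A \<noteq> {}" using k \<open>S \<subseteq> A\<close> by auto
  qed
  then obtain s where s: "\<And>n. s n \<in> T" and lim: "s \<longlonglongrightarrow> h"
    unfolding closure_sequential by auto
  have "(\<lambda>n. \<integral>\<omega>. norm_gain w0 w1 (V \<omega>) (s n) \<partial>M) \<longlonglongrightarrow> (\<integral>\<omega>. norm_gain w0 w1 (V \<omega>) h \<partial>M)"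
  proof (rule integral_dominated_convergence[where w = "\<lambda>_. 2 * (w0 + w1) * R"])
    \<comment> \<open>\<open>sgn\<close> is discontinuous only at 0, so convergence can fail only
      where \<open>V \<omega> = h\<close>, a null event by \<open>nz\<close>.\<close>
    show "AE \<omega> in M. (\<lambda>n. norm_gain w0 w1 (V \<omega>) (s n)) \<longlonglongrightarrow> norm_gain w0 w1 (V \<omega>) h"
      using nz[OF h]
    proof eventually_elim
      case (elim \<omega>)
      then show ?case unfolding norm_gain_def by (intro tendsto_intros lim) simp
    qed
    show "AE \<omega> in M. norm (norm_gain w0 w1 (V \<omega>) (s n)) \<le> 2 * (w0 + w1) * R" for n
    proof (rule AE_I2)
      fix \<omega>
      have "norm (norm_gain w0 w1 (V \<omega>) (s n)) \<le> 2 * (w0 + w1) * norm (s n)"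
        using abs_norm_gain_le[of w0 w1 "V \<omega>" "s n"] w by simp
      also have "\<dots> \<le> 2 * (w0 + w1) * R"
        using s[of n] w by (intro mult_left_mono) (auto simp: T_def)
      finally show "norm (norm_gain w0 w1 (V \<omega>) (s n)) \<le> 2 * (w0 + w1) * R" .
    qed
  qed measurable
  moreover have "(\<lambda>n. (w0 + w1 / 2) * (L * (norm (s n))\<^sup>2)) \<longlonglongrightarrow> (w0 + w1 / 2) * (L * (norm h)\<^sup>2)"
    by (intro tendsto_intros lim)
  ultimately show ?thesis
    by (rule LIMSEQ_le) (use s in \<open>auto simp: T_def\<close>)
qed

text \<open>Collects everything that needs an estimate into \<open>norm_gain a d\<close>; the
  remaining terms have explicit means. At \<open>x = z\<close> the convention
  \<open>sgn 0 = 0\<close> agrees with that of \<open>grad_g\<close>.\<close>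

lemma grad_g_inner:
  assumes v_def: "v = x - \<mu>" and h_def: "h = z - \<mu>" and d_def: "d = a - \<rho>"
  shows "grad_g x (z, a) \<bullet> ((z, a) - (\<mu>, \<rho>))
    = (norm h)\<^sup>2 - v \<bullet> h + a * d - norm_gain a d v h + (a + d) * (sgn v \<bullet> h) - d * norm v"
proof -
  have zx: "z - x = h - v" by (simp add: v_def h_def)
  have "grad_g x (z, a) \<bullet> ((z, a) - (\<mu>, \<rho>)) = (h - v - a *\<^sub>R sgn (h - v)) \<bullet> h + (a - norm (h - v)) * d"
    by (simp add: grad_g_def Let_def zx h_def[symmetric] d_def[symmetric] inner_prod_def sgn_div_norm divide_inverse)
  then show ?thesis
    by (simp add: norm_gain_def inner_diff_left inner_add_left dot_square_norm algebra_simps)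
qed

text \<open>The gain costs at most \<open>L * (\<rho> + 3 / 2 * R')\<close> times the squared
  distance in \<open>z\<close>. The cross term between centre and radius is split by a weighted
  square with weight \<open>A\<close>, which leaves \<open>1 - A\<close> for the radius and removes
  \<open>(norm u)\<^sup>2 / A\<close> from the centre.\<close>

lemma (in prob_space) grad_g_strongly_monotone:
  fixes X :: "'a \<Rightarrow> real^'n"
  assumes X [measurable]: "X \<in> borel_measurable M"
    and nonatomic: "\<And>z. z \<in> cball \<mu> R \<Longrightarrow> AE \<omega> in M. X \<omega> \<noteq> z"
    and card: "CARD('n) \<ge> 2" and R: "R > 0" and "R' > 0"
    and L: "\<And>z. z \<in> cball \<mu> R \<Longrightarrow> lambda_max (Gamma_mat M X z) \<le> L"
    and int: "integrable M (\<lambda>\<omega>. norm (X \<omega> - \<mu>))"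
    and \<rho>: "\<rho> = (\<integral>\<omega>. norm (X \<omega> - \<mu>) \<partial>M)"
    and u: "u = (\<integral>\<omega>. sgn (X \<omega> - \<mu>) \<partial>M)"
    and mean: "(\<integral>\<omega>. X \<omega> - \<mu> \<partial>M) = \<rho> *\<^sub>R u"
    and z: "z \<in> cball \<mu> R" and a: "a \<le> \<rho> + R'" and A: "A > 0"
  shows "(1 - (norm u)\<^sup>2 / A - L * (\<rho> + 3 / 2 * R')) * (norm (z - \<mu>))\<^sup>2 + (1 - A) * (a - \<rho>)\<^sup>2
      \<le> (\<integral>\<omega>. grad_g (X \<omega>) (z, a) \<bullet> ((z, a) - (\<mu>, \<rho>)) \<partial>M)"
proof -
  define V where "V \<omega> = X \<omega> - \<mu>" for \<omega>
  have [measurable]: "V \<in> borel_measurable M" unfolding V_def by measurable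
  define h where "h = z - \<mu>"
  define d where "d = a - \<rho>"
  have \<rho>0: "0 \<le> \<rho>" by (simp add: \<rho>)
  have eq: "grad_g (X \<omega>) (z, a) \<bullet> ((z, a) - (\<mu>, \<rho>))
    = (norm h)\<^sup>2 - V \<omega> \<bullet> h + a * d - norm_gain a d (V \<omega>) h + (a + d) * (sgn (V \<omega>) \<bullet> h) - d * norm (V \<omega>)" for \<omega>
    by (rule grad_g_inner[OF V_def h_def d_def])
  have iV: "integrable M V"
    unfolding V_def by (rule Bochner_Integration.integrable_bound[OF int]) auto
  have isg: "integrable M (\<lambda>\<omega>. sgn (V \<omega>))"
    by (rule integrable_const_bound[where B = 1]) (auto simp: norm_sgn)
  have ig: "integrable M (\<lambda>\<omega>. norm_gain w0 w1 (V \<omega>) h)" for w0 w1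
    by (rule integrable_norm_gain) measurable
  have iN: "integrable M (\<lambda>\<omega>. norm (V \<omega>))" using int by (simp add: V_def)
  have "(\<integral>\<omega>. grad_g (X \<omega>) (z, a) \<bullet> ((z, a) - (\<mu>, \<rho>)) \<partial>M)
    = (norm h)\<^sup>2 - (\<integral>\<omega>. V \<omega> \<partial>M) \<bullet> h + a * d - (\<integral>\<omega>. norm_gain a d (V \<omega>) h \<partial>M)
      + (a + d) * ((\<integral>\<omega>. sgn (V \<omega>) \<partial>M) \<bullet> h) - d * (\<integral>\<omega>. norm (V \<omega>) \<partial>M)"
    unfolding eq using iV isg ig iN by (simp add: prob_space)
  \<comment> \<open>The terms in \<open>u \<bullet> h\<close> have total coefficient
    \<open>a + d - \<rho> = 2 * d\<close>, and
    \<open>a * d - d * \<rho> = d\<^sup>2\<close>.\<close>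
  also have "\<dots> = (norm h)\<^sup>2 + d\<^sup>2 + 2 * d * (u \<bullet> h) - (\<integral>\<omega>. norm_gain a d (V \<omega>) h \<partial>M)"
    using mean unfolding u V_def[symmetric] \<rho>[folded V_def, symmetric] d_def
    by (simp add: power2_eq_square algebra_simps)
  finally have E: "(\<integral>\<omega>. grad_g (X \<omega>) (z, a) \<bullet> ((z, a) - (\<mu>, \<rho>)) \<partial>M)
    = (norm h)\<^sup>2 + d\<^sup>2 + 2 * d * (u \<bullet> h) - (\<integral>\<omega>. norm_gain a d (V \<omega>) h \<partial>M)" .
  \<comment> \<open>Here \<open>a \<le> \<rho> + R'\<close> and \<open>d \<le> R'\<close>. The
    second weight counts half, so \<open>(\<rho> + R') + R' / 2\<close> is the denominator in
    [A3].\<close>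
  have "(\<integral>\<omega>. norm_gain a d (V \<omega>) h \<partial>M) \<le> (\<integral>\<omega>. norm_gain (\<rho> + R') R' (V \<omega>) h \<partial>M)"
    by (intro integral_mono ig norm_gain_mono) (use a in \<open>simp_all add: d_def\<close>)
  also have "\<dots> \<le> ((\<rho> + R') + R' / 2) * (L * (norm h)\<^sup>2)"
  proof (rule expectation_norm_gain_le[OF _ _ card R])
    fix z' :: "real^'n" assume z': "z' \<in> cball 0 R"
    then have cb: "\<mu> + z' \<in> cball \<mu> R" by (simp add: dist_norm)
    have shift: "X \<omega> - (\<mu> + z') = V \<omega> - z'" for \<omega> by (simp add: V_def)
    show "AE \<omega> in M. V \<omega> \<noteq> z'"
      using nonatomic[OF cb] by eventually_elim (auto simp: V_def)
    show "lambda_max (Gamma_mat M V z') \<le> L"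
      using L[OF cb] by (simp add: Gamma_mat_def shift)
  qed (use \<rho>0 \<open>R' > 0\<close> z in \<open>auto simp: h_def dist_norm norm_minus_commute\<close>)
  finally have gain: "(\<integral>\<omega>. norm_gain a d (V \<omega>) h \<partial>M) \<le> L * (\<rho> + 3 / 2 * R') * (norm h)\<^sup>2"
    by (simp add: algebra_simps)
  have "(u \<bullet> h)\<^sup>2 \<le> (norm u)\<^sup>2 * (norm h)\<^sup>2"
    using Cauchy_Schwarz_ineq[of u h] by (simp add: power2_norm_eq_inner)
  then have cs: "(u \<bullet> h)\<^sup>2 / A \<le> (norm u)\<^sup>2 / A * (norm h)\<^sup>2"
    using A by (simp add: field_simps)
  \<comment> \<open>Completing the square in \<open>d\<close> bounds the cross term from
    below.\<close>
  have "0 \<le> (A * d + u \<bullet> h)\<^sup>2 / A" using A by simp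
  also have "(A * d + u \<bullet> h)\<^sup>2 / A = A * d\<^sup>2 + 2 * d * (u \<bullet> h) + (u \<bullet> h)\<^sup>2 / A"
    using A by (simp add: power2_eq_square field_simps)
  finally show "(1 - (norm u)\<^sup>2 / A - L * (\<rho> + 3 / 2 * R')) * (norm (z - \<mu>))\<^sup>2 + (1 - A) * (a - \<rho>)\<^sup>2
      \<le> (\<integral>\<omega>. grad_g (X \<omega>) (z, a) \<bullet> ((z, a) - (\<mu>, \<rho>)) \<partial>M)"
    unfolding E using gain cs by (simp add: h_def[symmetric] d_def[symmetric] algebra_simps)
qed

section \<open>Powers of the squared error and the step-size recursion\<close>

text \<open>Keep the binomial terms of order 0 and 1. Each higher term carries
  \<open>(g * sqrt W)\<^sup>2\<close>, hence is of size \<open>g\<^sup>2 * W ^ (p - 1)\<close>,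
  which \<open>g * T \<le> W\<close> turns into \<open>(g / T) * W ^ p\<close>. The factor
  \<open>6 ^ p\<close> is \<open>2 ^ p\<close> from the binomial coefficients times
  \<open>3 ^ p\<close> from the bound on \<open>\<xi>\<close>.\<close>

lemma power_perturbation_le:
  fixes D \<xi> W g V T :: real
  assumes D: "0 \<le> D" "D \<le> W" and g: "0 < g" and W: "g * T \<le> W" "g\<^sup>2 \<le> W"
    and T: "1 \<le> T" and V: "1 \<le> V" and \<xi>: "\<bar>\<xi>\<bar> \<le> 3 * (g * sqrt W) * V\<^sup>2" and p: "1 \<le> p"
  shows "(D + \<xi>) ^ p \<le> D ^ p + real p * \<xi> * D ^ (p - 1) + 6 ^ p * V ^ (2 * p) * (g / T) * W ^ p"
proof -
  have W0: "0 \<le> W" using D by simp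
  have gW: "g * sqrt W \<le> W"
  proof -
    have "g \<le> sqrt W" using W(2) by (rule real_le_rsqrt)
    then have "g * sqrt W \<le> sqrt W * sqrt W" using W0 by (intro mult_right_mono) auto
    then show ?thesis using W0 by simp
  qed
  have gT: "g\<^sup>2 * W ^ (p - 1) \<le> (g / T) * W ^ p"
  proof -
    have "g\<^sup>2 * W ^ (p - 1) = (g / T) * (g * T) * W ^ (p - 1)" using T by (simp add: power2_eq_square)
    also have "\<dots> \<le> (g / T) * W * W ^ (p - 1)"
      using W W0 g T by (intro mult_right_mono mult_left_mono) auto
    also have "\<dots> = (g / T) * W ^ p" using p by (cases p) auto
    finally show ?thesis .
  qed
  have term_le: "real (p choose k) * \<xi> ^ k * D ^ (p - k) \<le> real (p choose k) * (3 ^ p * V ^ (2 * p) * ((g / T) * W ^ p))"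
    if k: "k \<in> {2..p}" for k
  proof -
    have "\<xi> ^ k * D ^ (p - k) \<le> \<bar>\<xi>\<bar> ^ k * D ^ (p - k)"
      using D by (intro mult_right_mono) (auto simp: power_abs[symmetric])
    also have "\<dots> \<le> (3 * (g * sqrt W) * V\<^sup>2) ^ k * W ^ (p - k)"
      using \<xi> D by (intro mult_mono power_mono) auto
    also have "\<dots> = (3 * V\<^sup>2) ^ k * ((g * sqrt W) ^ k * W ^ (p - k))"
      by (simp add: power_mult_distrib)
    also have "\<dots> \<le> (3 * V\<^sup>2) ^ p * (g\<^sup>2 * W ^ (p - 1))"
    proof (rule mult_mono)
      have "1 \<le> V\<^sup>2" using V by (simp add: one_le_power)
      then have "1 \<le> 3 * V\<^sup>2" by linarith
      then show "(3 * V\<^sup>2) ^ k \<le> (3 * V\<^sup>2) ^ p" using k by (intro power_increasing) auto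
      \<comment> \<open>Two factors are kept to produce \<open>g\<^sup>2\<close>; the other
        \<open>k - 2\<close> are bounded by \<open>W\<close>.\<close>
      have "(g * sqrt W) ^ k = (g * sqrt W) ^ 2 * (g * sqrt W) ^ (k - 2)"
      proof -
        have "2 \<le> k" using k by simp
        then have "2 + (k - 2) = k" by (rule le_add_diff_inverse)
        then show ?thesis by (metis power_add)
      qed
      also have "\<dots> \<le> (g * sqrt W) ^ 2 * W ^ (k - 2)"
        using gW g W0 by (intro mult_left_mono power_mono) auto
      also have "(g * sqrt W) ^ 2 = g\<^sup>2 * W" using W0 by (simp add: power_mult_distrib)
      finally have "(g * sqrt W) ^ k * W ^ (p - k) \<le> g\<^sup>2 * W * W ^ (k - 2) * W ^ (p - k)"
        using W0 by (intro mult_right_mono) auto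
      also have "\<dots> = g\<^sup>2 * W ^ (1 + (k - 2) + (p - k))" by (simp only: power_add power_one_right mult.assoc)
      also have "1 + (k - 2) + (p - k) = p - 1" using k by auto
      finally show "(g * sqrt W) ^ k * W ^ (p - k) \<le> g\<^sup>2 * W ^ (p - 1)" .
    qed (use W0 g in auto)
    also have "\<dots> \<le> (3 * V\<^sup>2) ^ p * ((g / T) * W ^ p)" using gT by (intro mult_left_mono) auto
    also have "(3 * V\<^sup>2) ^ p = 3 ^ p * V ^ (2 * p)" by (simp add: power_mult_distrib power_mult)
    finally have "\<xi> ^ k * D ^ (p - k) \<le> 3 ^ p * V ^ (2 * p) * ((g / T) * W ^ p)" .
    then show ?thesis unfolding mult.assoc by (rule mult_left_mono) simp
  qed
  have "(D + \<xi>) ^ p = (\<Sum>k\<le>p. real (p choose k) * \<xi> ^ k * D ^ (p - k))"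
    using binomial_ring[of \<xi> D p] by (simp add: add.commute)
  also have "{..p} = {0, 1} \<union> {2..p}" using p by auto
  also have "(\<Sum>k\<in>{0, 1} \<union> {2..p}. real (p choose k) * \<xi> ^ k * D ^ (p - k))
    = (\<Sum>k\<in>{0, 1}. real (p choose k) * \<xi> ^ k * D ^ (p - k)) + (\<Sum>k\<in>{2..p}. real (p choose k) * \<xi> ^ k * D ^ (p - k))"
    by (rule sum.union_disjoint) auto
  also have "(\<Sum>k\<in>{0, 1}. real (p choose k) * \<xi> ^ k * D ^ (p - k)) = D ^ p + real p * \<xi> * D ^ (p - 1)"
    by simp
  also have "(\<Sum>k\<in>{2..p}. real (p choose k) * \<xi> ^ k * D ^ (p - k))
    \<le> (\<Sum>k\<in>{2..p}. real (p choose k) * (3 ^ p * V ^ (2 * p) * ((g / T) * W ^ p)))"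
    by (intro sum_mono term_le)
  also have "\<dots> = (\<Sum>k\<in>{2..p}. real (p choose k)) * (3 ^ p * V ^ (2 * p) * ((g / T) * W ^ p))"
    by (simp only: sum_distrib_right)
  also have "\<dots> \<le> 2 ^ p * (3 ^ p * V ^ (2 * p) * ((g / T) * W ^ p))"
  proof (rule mult_right_mono)
    have "(\<Sum>k\<in>{2..p}. real (p choose k)) \<le> (\<Sum>k\<le>p. real (p choose k))"
      by (intro sum_mono2) auto
    also have "\<dots> = 2 ^ p" using choose_row_sum[of p] by (metis of_nat_numeral of_nat_power of_nat_sum)
    finally show "(\<Sum>k\<in>{2..p}. real (p choose k)) \<le> 2 ^ p" .
  qed (use V g T W0 in auto)
  also have "\<dots> = 6 ^ p * V ^ (2 * p) * (g / T) * W ^ p"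
    using power_mult_distrib[of "2::real" 3 p] by (simp add: mult.assoc)
  finally show ?thesis by simp
qed

text \<open>The first-order term in \<open>L\<close> is kept exactly, since its mean gives the
  contraction. All other terms go into a remainder with the factor \<open>g / T\<close>, where
  \<open>T\<close> is still free.\<close>

lemma descent_power_le:
  fixes s g L V T :: real
  assumes s: "0 \<le> s" and g: "0 < g" "g \<le> 1" and V: "1 \<le> V" and T: "1 \<le> T"
    and L: "\<bar>L\<bar> \<le> s * V" and x: "0 \<le> x" "x \<le> s\<^sup>2 - 2 * g * L + g\<^sup>2 * V\<^sup>2" and p: "1 \<le> p"
  shows "x ^ p \<le> (s\<^sup>2) ^ p - 2 * real p * g * L * (s\<^sup>2) ^ (p - 1)
    + (6 ^ p + real p) * V ^ (2 * p) * (g / T) * ((s\<^sup>2) ^ p + (g * T) ^ p)"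
proof -
  \<comment> \<open>The maximum dominates the squared error and \<open>g * T\<close> at once, while
    \<open>W ^ p\<close> is at most the sum of their \<open>p\<close>-th powers.\<close>
  define W where "W = max (s\<^sup>2) (g * T)"
  define \<xi> where "\<xi> = - 2 * g * L + g\<^sup>2 * V\<^sup>2"
  have W: "s\<^sup>2 \<le> W" "g * T \<le> W" by (simp_all add: W_def)
  have W0: "0 \<le> W" using W(1) zero_le_power2[of s] by linarith
  have "g\<^sup>2 \<le> g * T" unfolding power2_eq_square using g T by (intro mult_left_mono) auto
  then have gW: "g\<^sup>2 \<le> W" using W(2) by linarith
  have sW: "s \<le> sqrt W" "g \<le> sqrt W" using W(1) gW by (simp_all add: real_le_rsqrt)
  have VV: "V \<le> V\<^sup>2" using V by (simp add: power2_eq_square)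
  have "\<bar>\<xi>\<bar> \<le> 2 * g * \<bar>L\<bar> + g\<^sup>2 * V\<^sup>2"
    unfolding \<xi>_def using g abs_triangle_ineq[of "- 2 * g * L" "g\<^sup>2 * V\<^sup>2"] by (simp add: abs_mult)
  also have "\<dots> \<le> 2 * g * (s * V) + g\<^sup>2 * V\<^sup>2" using L g by simp
  also have "\<dots> \<le> 2 * g * (sqrt W * V\<^sup>2) + (g * sqrt W) * V\<^sup>2"
    using sW VV s g V W0 by (intro add_mono mult_left_mono mult_mono mult_right_mono) (auto simp: power2_eq_square)
  finally have \<xi>: "\<bar>\<xi>\<bar> \<le> 3 * (g * sqrt W) * V\<^sup>2" by simp
  have "x ^ p \<le> (s\<^sup>2 + \<xi>) ^ p" using x by (intro power_mono) (auto simp: \<xi>_def)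
  also have "\<dots> \<le> (s\<^sup>2) ^ p + real p * \<xi> * (s\<^sup>2) ^ (p - 1) + 6 ^ p * V ^ (2 * p) * (g / T) * W ^ p"
    by (rule power_perturbation_le) (use s g W gW T V \<xi> p in auto)
  also have "real p * \<xi> * (s\<^sup>2) ^ (p - 1) = - 2 * real p * g * L * (s\<^sup>2) ^ (p - 1) + real p * (V\<^sup>2 * (g\<^sup>2 * (s\<^sup>2) ^ (p - 1)))"
    by (simp add: \<xi>_def algebra_simps)
  finally have 1: "x ^ p \<le> (s\<^sup>2) ^ p + (- 2 * real p * g * L * (s\<^sup>2) ^ (p - 1)
      + real p * (V\<^sup>2 * (g\<^sup>2 * (s\<^sup>2) ^ (p - 1)))) + 6 ^ p * V ^ (2 * p) * (g / T) * W ^ p" .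
  \<comment> \<open>The quadratic part of \<open>\<xi>\<close> in the linear binomial term is of
    second order as well and joins the remainder.\<close>
  have "V\<^sup>2 * (g\<^sup>2 * (s\<^sup>2) ^ (p - 1)) \<le> V ^ (2 * p) * ((g / T) * W ^ p)"
  proof (rule mult_mono)
    show "V\<^sup>2 \<le> V ^ (2 * p)" using V p by (intro power_increasing) auto
    have "g\<^sup>2 * (s\<^sup>2) ^ (p - 1) = (g / T) * ((g * T) * (s\<^sup>2) ^ (p - 1))" using T by (simp add: power2_eq_square)
    also have "\<dots> \<le> (g / T) * (W * W ^ (p - 1))"
      using W W0 g T by (intro mult_left_mono mult_mono power_mono) auto
    also have "W * W ^ (p - 1) = W ^ p" using p by (cases p) auto
    finally show "g\<^sup>2 * (s\<^sup>2) ^ (p - 1) \<le> (g / T) * W ^ p" .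
  qed (use V in auto)
  then have "real p * (V\<^sup>2 * (g\<^sup>2 * (s\<^sup>2) ^ (p - 1))) \<le> real p * (V ^ (2 * p) * ((g / T) * W ^ p))"
    by (rule mult_left_mono) simp
  with 1 have "x ^ p \<le> (s\<^sup>2) ^ p + (- 2 * real p * g * L * (s\<^sup>2) ^ (p - 1) + real p * (V ^ (2 * p) * ((g / T) * W ^ p)))
      + 6 ^ p * V ^ (2 * p) * (g / T) * W ^ p" by linarith
  also have "(s\<^sup>2) ^ p + (- 2 * real p * g * L * (s\<^sup>2) ^ (p - 1) + real p * (V ^ (2 * p) * ((g / T) * W ^ p)))
      + 6 ^ p * V ^ (2 * p) * (g / T) * W ^ p
    = (s\<^sup>2) ^ p - 2 * real p * g * L * (s\<^sup>2) ^ (p - 1) + (6 ^ p + real p) * V ^ (2 * p) * (g / T) * W ^ p"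
    by (simp add: algebra_simps)
  also have "\<dots> \<le> (s\<^sup>2) ^ p - 2 * real p * g * L * (s\<^sup>2) ^ (p - 1)
    + (6 ^ p + real p) * V ^ (2 * p) * (g / T) * ((s\<^sup>2) ^ p + (g * T) ^ p)"
  proof (intro add_left_mono mult_left_mono)
    show "W ^ p \<le> (s\<^sup>2) ^ p + (g * T) ^ p" using g T by (auto simp: W_def max_def)
  qed (use V g T in auto)
  finally show ?thesis by simp
qed

section \<open>Decay of the step sizes and the scalar recursion\<close>

lemma eventually_powr_ge:
  fixes B b :: real
  assumes "0 < b"
  shows "eventually (\<lambda>n. B \<le> real n powr b) sequentially"
  using eventually_ge_at_top[of "nat \<lceil>max 1 B powr (1 / b)\<rceil>"]
proof eventually_elim
  case (elim n)
  then have "max 1 B powr (1 / b) \<le> real n" by linarith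
  then have "(max 1 B powr (1 / b)) powr b \<le> real n powr b"
    using assms by (intro powr_mono2) auto
  then show ?case using assms by (simp add: powr_powr)
qed

lemma step_size_power:
  assumes "m > 0"
  shows "(c * real m powr - \<alpha>) ^ p = c ^ p * real m powr - (real p * \<alpha>)"
  using assms by (simp add: power_mult_distrib powr_realpow[symmetric] powr_powr mult.commute)

text \<open>The relative decrease of the \<open>p\<close>-th power of the step is at most
  \<open>real p * \<alpha> / real n\<close>, which is of smaller order than the step itself because
  \<open>\<alpha> < 1\<close>.\<close>

lemma powr_step_decrease:
  fixes \<alpha> a c :: real
  assumes \<alpha>: "0 < \<alpha>" "\<alpha> < 1" and ac: "0 < a" "0 < c"
  shows "eventually (\<lambda>n. (c * real n powr - \<alpha>) ^ p - (c * real (Suc n) powr - \<alpha>) ^ p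
    \<le> a * (c * real n powr - \<alpha>) ^ Suc p) sequentially"
proof -
  let ?\<beta> = "real p * \<alpha>"
  have "eventually (\<lambda>n. ?\<beta> / (a * c) \<le> real n powr (1 - \<alpha>)) sequentially"
    by (rule eventually_powr_ge) (use \<alpha> in simp)
  then show ?thesis using eventually_gt_at_top[of 0]
  proof eventually_elim
    case (elim n)
    have n: "real n > 0" using elim by simp
    have "ln (real (Suc n) / real n) \<le> real (Suc n) / real n - 1"
      using n by (intro ln_le_minus_one) auto
    also have "\<dots> = 1 / real n" using n by (simp add: field_simps)
    finally have ln: "ln (real (Suc n) / real n) \<le> 1 / real n" .
    have "1 - ?\<beta> / real n \<le> 1 + - ?\<beta> * ln (real (Suc n) / real n)"
      using mult_left_mono[OF ln, of ?\<beta>] \<alpha> by simp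
    also have "\<dots> \<le> exp (- ?\<beta> * ln (real (Suc n) / real n))" by (rule exp_ge_add_one_self)
    also have "\<dots> = (real (Suc n) / real n) powr - ?\<beta>" using n by (simp add: powr_def)
    finally have b: "1 - ?\<beta> / real n \<le> (real (Suc n) / real n) powr - ?\<beta>" .
    have "real (Suc n) powr - ?\<beta> = real n powr - ?\<beta> * (real (Suc n) / real n) powr - ?\<beta>"
      using n by (subst powr_mult[symmetric]) auto
    also have "\<dots> \<ge> real n powr - ?\<beta> * (1 - ?\<beta> / real n)"
      using b by (intro mult_left_mono) auto
    finally have "real n powr - ?\<beta> - real (Suc n) powr - ?\<beta> \<le> real n powr - ?\<beta> * (?\<beta> / real n)"
      by (simp add: algebra_simps)
    also have "\<dots> \<le> real n powr - ?\<beta> * (a * (c * real n powr - \<alpha>))"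
    proof (intro mult_left_mono)
      have "?\<beta> \<le> real n powr (1 - \<alpha>) * (a * c)" using elim(1) ac by (simp add: pos_divide_le_eq)
      also have "real n powr (1 - \<alpha>) = real n * real n powr - \<alpha>"
        using n by (simp add: powr_diff powr_minus divide_inverse)
      finally show "?\<beta> / real n \<le> a * (c * real n powr - \<alpha>)" using n by (simp add: field_simps)
    qed auto
    finally have "c ^ p * (real n powr - ?\<beta> - real (Suc n) powr - ?\<beta>) \<le> c ^ p * (real n powr - ?\<beta> * (a * (c * real n powr - \<alpha>)))"
      using ac by (intro mult_left_mono) auto
    moreover have "Suc n > 0" "n > 0" using elim by auto
    ultimately show ?case
      unfolding power_Suc by (simp only: step_size_power) (simp add: algebra_simps)
  qed
qed

text \<open>A large multiple of \<open>\<gamma> n ^ p\<close> is a supersolution: half of the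
  contraction absorbs \<open>B\<close>, the other half absorbs the decrease of
  \<open>\<gamma> n ^ p\<close>.\<close>

lemma robbins_monro_recursion:
  fixes v \<gamma> :: "nat \<Rightarrow> real" and \<alpha> a c B :: real
  assumes \<alpha>: "0 < \<alpha>" "\<alpha> < 1" and ac: "0 < a" "0 < c"
    and \<gamma>: "\<And>n. n \<ge> 1 \<Longrightarrow> \<gamma> n = c * real n powr - \<alpha>"
    and rec: "eventually (\<lambda>n. v (Suc n) \<le> (1 - a * \<gamma> n) * v n + B * \<gamma> n ^ Suc p) sequentially"
  shows "\<exists>C > 0. \<forall>n\<ge>1. v n \<le> C / real n powr (real p * \<alpha>)"
proof -
  \<comment> \<open>The factor \<open>1 - a * \<gamma> n\<close> must be nonnegative before the
    induction hypothesis can be multiplied by it.\<close>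
  have "eventually (\<lambda>n. a * (c * real n powr - \<alpha>) \<le> 1) sequentially"
    using eventually_powr_ge[OF \<alpha>(1), of "a * c"] eventually_gt_at_top[of 0]
    by eventually_elim (simp add: powr_minus field_simps)
  then have "eventually (\<lambda>n. n \<ge> 1 \<and> a * \<gamma> n \<le> 1
     \<and> v (Suc n) \<le> (1 - a * \<gamma> n) * v n + B * \<gamma> n ^ Suc p
     \<and> \<gamma> n ^ p - \<gamma> (Suc n) ^ p \<le> a / 2 * \<gamma> n ^ Suc p) sequentially"
    using rec powr_step_decrease[OF \<alpha>, of "a / 2" c p, OF half_gt_zero[OF ac(1)] ac(2)]
      eventually_ge_at_top[of 1]
  proof eventually_elim
    case (elim n)
    have "\<gamma> (Suc n) = c * real (Suc n) powr - \<alpha>" by (rule \<gamma>) simp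
    then show ?case using elim \<gamma>[OF elim(4)] by (simp only: simp_thms)
  qed
  then obtain n0 where n0: "\<And>n. n \<ge> n0 \<Longrightarrow> n \<ge> 1 \<and> a * \<gamma> n \<le> 1
     \<and> v (Suc n) \<le> (1 - a * \<gamma> n) * v n + B * \<gamma> n ^ Suc p
     \<and> \<gamma> n ^ p - \<gamma> (Suc n) ^ p \<le> a / 2 * \<gamma> n ^ Suc p"
    unfolding eventually_sequentially by blast
  have \<gamma>pos: "\<gamma> n > 0" if "n \<ge> 1" for n using that ac by (simp add: \<gamma>)
  \<comment> \<open>The three entries give positivity, \<open>B \<le> a / 2 * M\<close>, and the
    start of the induction at \<open>n0\<close>.\<close>
  define M where "M = Max {1, 2 * B / a, v n0 / \<gamma> n0 ^ p}"
  have M: "1 \<le> M" "2 * B / a \<le> M" "v n0 / \<gamma> n0 ^ p \<le> M" by (simp_all add: M_def)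
  have MB: "B \<le> a / 2 * M" using M(2) ac by (simp add: field_simps)
  have tail: "v n \<le> M * \<gamma> n ^ p" if "n \<ge> n0" for n
    using that
  proof (induction n rule: dec_induct)
    case base
    then show ?case using M(3) \<gamma>pos[of n0] n0[of n0] by (simp add: pos_divide_le_eq)
  next
    case (step n)
    note n = n0[OF step(1)]
    have "v (Suc n) \<le> (1 - a * \<gamma> n) * v n + B * \<gamma> n ^ Suc p" using n by simp
    also have "\<dots> \<le> (1 - a * \<gamma> n) * (M * \<gamma> n ^ p) + (a / 2 * M) * \<gamma> n ^ Suc p"
      using n step.IH MB \<gamma>pos[of n] by (intro add_mono mult_left_mono mult_right_mono) auto
    also have "\<dots> = M * (\<gamma> n ^ p - a / 2 * \<gamma> n ^ Suc p)" by (simp add: algebra_simps)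
    also have "\<dots> \<le> M * \<gamma> (Suc n) ^ p" using n M(1) by (intro mult_left_mono) auto
    finally show ?case .
  qed
  \<comment> \<open>The finite sum covers the indices before \<open>n0\<close>.\<close>
  define C where "C = M + (\<Sum>i\<in>{1..n0}. \<bar>v i\<bar> / \<gamma> i ^ p)"
  have pos: "0 \<le> \<bar>v i\<bar> / \<gamma> i ^ p" if "i \<in> {1..n0}" for i
    using \<gamma>pos[of i] that by simp
  then have "0 \<le> (\<Sum>i\<in>{1..n0}. \<bar>v i\<bar> / \<gamma> i ^ p)" by (rule sum_nonneg)
  then have C: "M \<le> C" "0 < C" using M(1) by (simp_all add: C_def)
  have vC: "v n \<le> C * \<gamma> n ^ p" if n: "n \<ge> 1" for n
  proof (cases "n \<ge> n0")
    case True
    have "M * \<gamma> n ^ p \<le> C * \<gamma> n ^ p" using C \<gamma>pos[OF n] by (intro mult_right_mono) auto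
    then show ?thesis using tail[OF True] by linarith
  next
    case False
    then have "\<bar>v n\<bar> / \<gamma> n ^ p \<le> (\<Sum>i\<in>{1..n0}. \<bar>v i\<bar> / \<gamma> i ^ p)"
      using n pos by (intro member_le_sum) auto
    also have "\<dots> \<le> C" using M(1) by (simp add: C_def)
    finally have "\<bar>v n\<bar> \<le> C * \<gamma> n ^ p" using \<gamma>pos[OF n] by (simp add: pos_divide_le_eq)
    then show ?thesis by linarith
  qed
  show ?thesis
  proof (intro exI[of _ "C * c ^ p"] conjI allI impI)
    show "0 < C * c ^ p" using C ac by simp
    fix n :: nat assume n: "1 \<le> n"
    have "\<gamma> n ^ p = c ^ p / real n powr (real p * \<alpha>)"
      unfolding \<gamma>[OF n] using n by (subst step_size_power) (simp_all add: powr_minus divide_inverse)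
    then show "v n \<le> C * c ^ p / real n powr (real p * \<alpha>)" using vC[OF n] by simp
  qed
qed

section \<open>Processes driven by an independent sequence\<close>

lemma measurable_grad_g [measurable (raw)]:
  fixes f :: "'a \<Rightarrow> real^'n" and h :: "'a \<Rightarrow> (real^'n) \<times> real"
  assumes [measurable]: "f \<in> borel_measurable M" "h \<in> borel_measurable M"
  shows "(\<lambda>x. grad_g (f x) (h x)) \<in> borel_measurable M"
proof -
  have [measurable]: "(\<lambda>x. fst (h x)) \<in> borel_measurable M" "(\<lambda>x. snd (h x)) \<in> borel_measurable M"
    using assms(2) by (simp_all add: borel_prod[symmetric])
  show ?thesis unfolding grad_g_def Let_def by measurable
qed

text \<open>
  The state at time \<open>n\<close> depends only on the inputs up to time \<open>n\<close>, hence is independent of the next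
  input, which can therefore be integrated out first.
\<close>
lemma (in prob_space) driven_process:
  fixes X :: "nat \<Rightarrow> 'a \<Rightarrow> 'b::second_countable_topology"
    and Y :: "nat \<Rightarrow> 'a \<Rightarrow> 'c::second_countable_topology"
    and f :: "nat \<Rightarrow> 'b \<Rightarrow> 'c \<Rightarrow> 'c"
  assumes indep: "indep_vars (\<lambda>_. borel) X {1..}"
    and f [measurable]: "\<And>n. case_prod (f n) \<in> borel \<Otimes>\<^sub>M borel \<rightarrow>\<^sub>M borel"
    and init: "\<And>\<omega>. \<omega> \<in> space M \<Longrightarrow> Y 1 \<omega> = y"
    and step: "\<And>n \<omega>. n \<ge> 1 \<Longrightarrow> \<omega> \<in> space M \<Longrightarrow> Y (n + 1) \<omega> = f n (X (n + 1) \<omega>) (Y n \<omega>)"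
    and n: "n \<ge> 1"
  shows "Y n \<in> borel_measurable M"
    and "F \<in> borel_measurable (borel \<Otimes>\<^sub>M borel) \<Longrightarrow>
      (\<integral>\<^sup>+\<omega>. F (Y n \<omega>, X (n + 1) \<omega>) \<partial>M)
        = (\<integral>\<^sup>+\<omega>. (\<integral>\<^sup>+x. F (Y n \<omega>, x) \<partial>distr M borel (X (n + 1))) \<partial>M)"
proof -
  \<comment> \<open>\<open>S k\<close> is the state at time \<open>k + 1\<close> as a function of
    the input path; it reads only the inputs 2 to \<open>k + 1\<close>.\<close>
  define S where "S = rec_nat (\<lambda>x. y) (\<lambda>n s x. f (Suc n) (x (n + 2)) (s x))"
  have S0: "S 0 x = y" and SS: "S (Suc n) x = f (Suc n) (x (n + 2)) (S n x)" for n x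
    by (simp_all add: S_def)
  have [measurable]: "X i \<in> borel_measurable M" if "i \<ge> 1" for i
    using indep that by (simp add: indep_vars_def)
  have S_meas: "S n \<in> PiM {1..n + 1} (\<lambda>_. borel) \<rightarrow>\<^sub>M borel" for n
  proof -
    have "S m \<in> PiM {1..n + 1} (\<lambda>_. borel) \<rightarrow>\<^sub>M borel" if "m \<le> n" for m
      using that
    proof (induction m)
      case 0
      have "S 0 = (\<lambda>x. y)" by (simp add: fun_eq_iff S0)
      then show ?case by simp
    next
      case (Suc m)
      have [measurable]: "S m \<in> PiM {1..n + 1} (\<lambda>_. borel) \<rightarrow>\<^sub>M borel" using Suc by simp
      have [measurable]: "(\<lambda>x. x (m + 2)) \<in> PiM {1..n + 1} (\<lambda>_. borel :: 'b measure) \<rightarrow>\<^sub>M borel"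
        by (rule measurable_component_singleton) (use Suc.prems in auto)
      have "(\<lambda>x. case_prod (f (Suc m)) (x (m + 2), S m x)) \<in> PiM {1..n + 1} (\<lambda>_. borel) \<rightarrow>\<^sub>M borel"
        by measurable
      moreover have "S (Suc m) = (\<lambda>x. case_prod (f (Suc m)) (x (m + 2), S m x))"
        by (simp add: fun_eq_iff SS)
      ultimately show ?case by simp
    qed
    then show ?thesis by simp
  qed
  have S_restrict: "S n (restrict x {1..n + 1}) = S n x" for n x
  proof -
    have "S m (restrict x {1..n + 1}) = S m x" if "m \<le> n" for m
      using that by (induction m) (simp_all add: S0 SS)
    then show ?thesis by simp
  qed
  have YS: "Y (Suc n) \<omega> = S n (\<lambda>i. X i \<omega>)" if "\<omega> \<in> space M" for n \<omega>
    using that step[of "Suc m" \<omega> for m] init by (induction n) (simp_all add: S0 SS)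
  obtain m where m: "n = Suc m" using n by (cases n) auto
  \<comment> \<open>With \<open>n = m + 1\<close>, the state at time \<open>n\<close> depends on the
    block of inputs up to \<open>m + 1\<close>, and the next input is the one-element block
    \<open>{m + 2}\<close>.\<close>
  define A where "A = PiM {1..m + 1} (\<lambda>_. borel :: 'b measure)"
  define B where "B = PiM {m + 2} (\<lambda>_. borel :: 'b measure)"
  define a where "a \<omega> = restrict (\<lambda>i. X i \<omega>) {1..m + 1}" for \<omega>
  define b where "b \<omega> = restrict (\<lambda>i. X i \<omega>) {m + 2}" for \<omega>
  define e :: "(nat \<Rightarrow> 'b) \<Rightarrow> 'b" where "e x = x (m + 2)" for x
  have ab: "indep_var A a B b"
    unfolding A_def B_def a_def b_def by (rule indep_var_restrict[OF indep]) auto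
  have [measurable]: "a \<in> M \<rightarrow>\<^sub>M A" "b \<in> M \<rightarrow>\<^sub>M B"
    using ab by (auto dest: indep_var_rv1 indep_var_rv2)
  have pair: "distr M A a \<Otimes>\<^sub>M distr M B b = distr M (A \<Otimes>\<^sub>M B) (\<lambda>\<omega>. (a \<omega>, b \<omega>))"
    using ab by (simp add: indep_var_distribution_eq)
  have Ya: "Y n \<omega> = S m (a \<omega>)" if "\<omega> \<in> space M" for \<omega>
    unfolding m a_def S_restrict by (rule YS[OF that])
  have Xb: "X (Suc n) \<omega> = e (b \<omega>)" for \<omega> by (simp add: m b_def e_def)
  have [measurable]: "S m \<in> A \<rightarrow>\<^sub>M borel" unfolding A_def by (rule S_meas)
  have [measurable]: "e \<in> B \<rightarrow>\<^sub>M borel"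
    unfolding B_def e_def by (rule measurable_component_singleton) simp
  show "Y n \<in> borel_measurable M"
    by (subst measurable_cong[OF Ya]) measurable
  interpret B: prob_space "distr M B b" by (rule prob_space_distr) measurable
  show "(\<integral>\<^sup>+\<omega>. F (Y n \<omega>, X (n + 1) \<omega>) \<partial>M)
        = (\<integral>\<^sup>+\<omega>. (\<integral>\<^sup>+x. F (Y n \<omega>, x) \<partial>distr M borel (X (n + 1))) \<partial>M)"
    if F [measurable]: "F \<in> borel_measurable (borel \<Otimes>\<^sub>M borel)"
  proof -
    have [measurable]: "(\<lambda>z. F (S m (fst z), e (snd z))) \<in> borel_measurable (A \<Otimes>\<^sub>M B)" by measurable
    have "(\<integral>\<^sup>+\<omega>. F (Y n \<omega>, X (n + 1) \<omega>) \<partial>M) = (\<integral>\<^sup>+\<omega>. F (S m (a \<omega>), e (b \<omega>)) \<partial>M)"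
      by (intro nn_integral_cong) (simp add: Ya Xb)
    also have "\<dots> = (\<integral>\<^sup>+z. F (S m (fst z), e (snd z)) \<partial>(distr M A a \<Otimes>\<^sub>M distr M B b))"
      unfolding pair by (subst nn_integral_distr) simp_all
    also have "\<dots> = (\<integral>\<^sup>+x. \<integral>\<^sup>+x'. F (S m x, e x') \<partial>distr M B b \<partial>distr M A a)"
      by (subst B.nn_integral_fst[symmetric]) simp_all
    also have "\<dots> = (\<integral>\<^sup>+\<omega>. \<integral>\<^sup>+x'. F (S m (a \<omega>), e x') \<partial>distr M B b \<partial>M)"
      by (subst nn_integral_distr) (simp_all, measurable)
    also have "\<dots> = (\<integral>\<^sup>+\<omega>. (\<integral>\<^sup>+x. F (Y n \<omega>, x) \<partial>distr M borel (X (n + 1))) \<partial>M)"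
    proof (rule nn_integral_cong)
      fix \<omega> assume "\<omega> \<in> space M"
      have X_eq: "X (n + 1) = (\<lambda>\<omega>. e (b \<omega>))" by (simp add: fun_eq_iff Xb)
      show "(\<integral>\<^sup>+x'. F (S m (a \<omega>), e x') \<partial>distr M B b) = (\<integral>\<^sup>+x. F (Y n \<omega>, x) \<partial>distr M borel (X (n + 1)))"
        unfolding X_eq Ya[OF \<open>\<omega> \<in> space M\<close>]
        by (subst (1 2) nn_integral_distr) simp_all
    qed
    finally show ?thesis .
  qed
qed

section \<open>Moments of projected Robbins--Monro iterates\<close>

text \<open>Integrates \<open>descent_power_le\<close> over one input from a fixed state. The
  first-order term contracts at rate \<open>2 * real p * \<kappa> * g\<close>, half of which is
  spent on the remainder.\<close>

lemma (in prob_space) expected_descent_step: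
  fixes G :: "'a \<Rightarrow> 'b::euclidean_space \<Rightarrow> 'b"
  assumes G [measurable]: "\<And>y. (\<lambda>x. G x y) \<in> borel_measurable M"
    and V [measurable]: "V \<in> borel_measurable M"
    and V1: "\<And>x. 1 \<le> V x" and GV: "\<And>x y. y \<in> K \<Longrightarrow> norm (G x y) \<le> V x"
    and int: "integrable M (\<lambda>x. V x ^ (2 * p))" and p: "1 \<le> p"
    and \<kappa>: "\<kappa> > 0" and mono: "\<And>y. y \<in> K \<Longrightarrow> \<kappa> * (norm (y - \<theta>))\<^sup>2 \<le> (\<integral>x. G x y \<bullet> (y - \<theta>) \<partial>M)"
  obtains B where "0 \<le> B" and "\<And>y g. y \<in> K \<Longrightarrow> 0 < g \<Longrightarrow> g \<le> 1 \<Longrightarrow>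
    (\<integral>\<^sup>+x. ennreal (norm (y - g *\<^sub>R G x y - \<theta>) ^ (2 * p)) \<partial>M)
      \<le> ennreal ((1 - real p * \<kappa> * g) * norm (y - \<theta>) ^ (2 * p) + B * g ^ Suc p)"
proof -
  define m where "m = (\<integral>x. V x ^ (2 * p) \<partial>M)"
  define k where "k = 6 ^ p + real p"
  \<comment> \<open>Chosen so that the mean remainder, with coefficient \<open>m * k / T\<close>, is
    at most \<open>real p * \<kappa>\<close>.\<close>
  define T where "T = max 1 (m * k / (real p * \<kappa>))"
  have T: "1 \<le> T" "m * k / (real p * \<kappa>) \<le> T" by (simp_all add: T_def)
  have mk: "m * k / T \<le> real p * \<kappa>"
    using T p \<kappa> by (simp add: pos_divide_le_eq mult.commute)
  have V0: "0 \<le> V x" for x using V1[of x] by linarith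
  have V_int: "integrable M V"
  proof (rule Bochner_Integration.integrable_bound[OF int])
    have "V x ^ 1 \<le> V x ^ (2 * p)" for x using V1 p by (intro power_increasing) auto
    then show "AE x in M. norm (V x) \<le> norm (V x ^ (2 * p))" using V0 by (simp add: abs_of_nonneg)
  qed simp
  show thesis
  proof (rule that)
    show "0 \<le> real p * \<kappa> * T ^ p" using T \<kappa> by simp
    fix y and g :: real assume y: "y \<in> K" and g: "0 < g" "g \<le> 1"
    define D where "D = (norm (y - \<theta>))\<^sup>2"
    have D0: "0 \<le> D" by (simp add: D_def)
    have DN: "D ^ p = norm (y - \<theta>) ^ (2 * p)" by (simp add: D_def power_mult)
    define L where "L x = G x y \<bullet> (y - \<theta>)" for x
    have [measurable]: "L \<in> borel_measurable M" unfolding L_def by measurable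
    have L_le: "\<bar>L x\<bar> \<le> norm (y - \<theta>) * V x" for x
    proof -
      have "\<bar>L x\<bar> \<le> norm (G x y) * norm (y - \<theta>)" unfolding L_def by (rule Cauchy_Schwarz_ineq2)
      also have "\<dots> \<le> V x * norm (y - \<theta>)" using GV[OF y] by (intro mult_right_mono) auto
      finally show ?thesis by (simp add: mult.commute)
    qed
    have L_int: "integrable M L"
      by (rule Bochner_Integration.integrable_bound[OF integrable_mult_right[OF V_int, of "norm (y - \<theta>)"]])
        (use L_le V0 in \<open>auto simp: abs_mult\<close>)
    define H where "H x = D ^ p - 2 * real p * g * L x * D ^ (p - 1)
      + k * V x ^ (2 * p) * (g / T) * (D ^ p + (g * T) ^ p)" for x
    have le: "norm (y - g *\<^sub>R G x y - \<theta>) ^ (2 * p) \<le> H x" for x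
    proof -
      let ?N = "(norm (y - g *\<^sub>R G x y - \<theta>))\<^sup>2"
      have "y - g *\<^sub>R G x y - \<theta> = (y - \<theta>) - g *\<^sub>R G x y" by simp
      then have "?N = D - 2 * g * L x + g\<^sup>2 * (norm (G x y))\<^sup>2"
        unfolding D_def L_def power2_norm_eq_inner
        by (simp only:) (simp add: inner_diff_left inner_diff_right inner_commute power2_eq_square algebra_simps)
      also have "\<dots> \<le> D - 2 * g * L x + g\<^sup>2 * (V x)\<^sup>2"
        using GV[OF y, of x] by (intro add_left_mono mult_left_mono power_mono) auto
      finally have "?N ^ p \<le> H x"
        unfolding H_def k_def D_def
        by (intro descent_power_le[OF _ g V1 T(1) L_le _ _ p]) auto
      then show ?thesis by (simp add: power_mult)
    qed
    have H0: "0 \<le> H x" for x using le[of x] by (rule order_trans[rotated]) simp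
    have H_int: "integrable M H" unfolding H_def using L_int int by simp
    have "(\<integral>\<^sup>+x. ennreal (norm (y - g *\<^sub>R G x y - \<theta>) ^ (2 * p)) \<partial>M) \<le> (\<integral>\<^sup>+x. ennreal (H x) \<partial>M)"
      by (intro nn_integral_mono ennreal_leI le)
    also have "\<dots> = ennreal (\<integral>x. H x \<partial>M)"
      by (rule nn_integral_eq_integral[OF H_int]) (simp add: H0)
    also have "\<dots> \<le> ennreal ((1 - real p * \<kappa> * g) * norm (y - \<theta>) ^ (2 * p) + real p * \<kappa> * T ^ p * g ^ Suc p)"
    proof (rule ennreal_leI)
      have "(\<integral>x. H x \<partial>M) = D ^ p - 2 * real p * g * (\<integral>x. L x \<partial>M) * D ^ (p - 1)
        + k * m * (g / T) * (D ^ p + (g * T) ^ p)"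
        unfolding H_def m_def using L_int int by (simp add: prob_space)
      also have "\<dots> \<le> D ^ p - 2 * real p * g * (\<kappa> * D ^ p) + real p * \<kappa> * g * (D ^ p + (g * T) ^ p)"
      proof (rule add_mono)
        have "\<kappa> * D ^ p = \<kappa> * D * D ^ (p - 1)" using p by (cases p) auto
        also have "\<dots> \<le> (\<integral>x. L x \<partial>M) * D ^ (p - 1)"
          using mono[OF y] D0 by (intro mult_right_mono) (auto simp: L_def D_def)
        finally have "2 * real p * g * (\<kappa> * D ^ p) \<le> 2 * real p * g * ((\<integral>x. L x \<partial>M) * D ^ (p - 1))"
          using g by (intro mult_left_mono) auto
        then show "D ^ p - 2 * real p * g * (\<integral>x. L x \<partial>M) * D ^ (p - 1)
          \<le> D ^ p - 2 * real p * g * (\<kappa> * D ^ p)" by (simp add: mult.assoc)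
        have "k * m * (g / T) * (D ^ p + (g * T) ^ p) = m * k / T * (g * (D ^ p + (g * T) ^ p))" by simp
        also have "\<dots> \<le> real p * \<kappa> * (g * (D ^ p + (g * T) ^ p))"
          using mk g T D0 by (intro mult_right_mono) auto
        finally show "k * m * (g / T) * (D ^ p + (g * T) ^ p) \<le> real p * \<kappa> * g * (D ^ p + (g * T) ^ p)"
          by (simp add: mult.assoc)
      qed
      also have "\<dots> = (1 - real p * \<kappa> * g) * D ^ p + real p * \<kappa> * T ^ p * g ^ Suc p"
        by (simp add: power_mult_distrib algebra_simps)
      finally show "(\<integral>x. H x \<partial>M) \<le> (1 - real p * \<kappa> * g) * norm (y - \<theta>) ^ (2 * p) + real p * \<kappa> * T ^ p * g ^ Suc p"
        unfolding DN .
    qed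
    finally show "(\<integral>\<^sup>+x. ennreal (norm (y - g *\<^sub>R G x y - \<theta>) ^ (2 * p)) \<partial>M)
      \<le> ennreal ((1 - real p * \<kappa> * g) * norm (y - \<theta>) ^ (2 * p) + real p * \<kappa> * T ^ p * g ^ Suc p)" .
  qed
qed

text \<open>The projection is nonexpansive and fixes \<open>\<theta>\<close>, so it can only reduce
  the error. Integrating out the next input for a fixed state gives the recursion for the moments;
  these are finite because the iterates stay in the bounded set \<open>K\<close>.\<close>

lemma (in prob_space) projected_robbins_monro_moment_le:
  fixes X :: "nat \<Rightarrow> 'a \<Rightarrow> 'b::second_countable_topology"
    and Y :: "nat \<Rightarrow> 'a \<Rightarrow> 'c::euclidean_space"
    and G :: "'b \<Rightarrow> 'c \<Rightarrow> 'c" and \<gamma> :: "nat \<Rightarrow> real"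
  assumes indep: "indep_vars (\<lambda>_. borel) X {1..}"
    and law: "\<And>n. n \<ge> 1 \<Longrightarrow> distr M borel (X n) = N"
    and G: "case_prod G \<in> borel \<Otimes>\<^sub>M borel \<rightarrow>\<^sub>M borel"
    and K: "bounded K" and proj: "\<And>y. proj y \<in> K" "proj \<theta> = \<theta>"
      "\<And>y y'. norm (proj y - proj y') \<le> norm (y - y')"
    and init: "y1 \<in> K" "\<And>\<omega>. \<omega> \<in> space M \<Longrightarrow> Y 1 \<omega> = y1"
    and step: "\<And>n \<omega>. n \<ge> 1 \<Longrightarrow> \<omega> \<in> space M \<Longrightarrow>
      Y (n + 1) \<omega> = proj (Y n \<omega> - \<gamma> n *\<^sub>R G (X (n + 1) \<omega>) (Y n \<omega>))"
    and V [measurable]: "V \<in> borel_measurable borel"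
    and V1: "\<And>x. 1 \<le> V x" and GV: "\<And>x y. y \<in> K \<Longrightarrow> norm (G x y) \<le> V x"
    and int: "integrable N (\<lambda>x. V x ^ (2 * p))" and p: "1 \<le> p"
    and \<kappa>: "\<kappa> > 0" and mono: "\<And>y. y \<in> K \<Longrightarrow> \<kappa> * (norm (y - \<theta>))\<^sup>2 \<le> (\<integral>x. G x y \<bullet> (y - \<theta>) \<partial>N)"
    and \<alpha>: "0 < \<alpha>" "\<alpha> < 1" and c: "0 < c" and \<gamma>: "\<And>n. n \<ge> 1 \<Longrightarrow> \<gamma> n = c * real n powr - \<alpha>"
  shows "\<And>n. n \<ge> 1 \<Longrightarrow> integrable M (\<lambda>\<omega>. norm (Y n \<omega> - \<theta>) ^ (2 * p))"
    and "\<exists>C > 0. \<forall>n\<ge>1. (\<integral>\<omega>. norm (Y n \<omega> - \<theta>) ^ (2 * p) \<partial>M) \<le> C / real n powr (real p * \<alpha>)"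
proof -
  have cont: "continuous_on UNIV proj"
    by (rule lipschitz_on_continuous_on[of 1], rule lipschitz_onI) (simp_all add: dist_norm proj(3))
  have [measurable]: "proj \<in> borel_measurable borel" using cont by (rule borel_measurable_continuous_onI)
  note [measurable] = G
  define f where "f n x y = proj (y - \<gamma> n *\<^sub>R G x y)" for n x y
  have f: "case_prod (f n) \<in> borel \<Otimes>\<^sub>M borel \<rightarrow>\<^sub>M borel" for n
  proof -
    have "case_prod (f n) = (\<lambda>z. proj (snd z - \<gamma> n *\<^sub>R case_prod G z))"
      by (simp add: f_def fun_eq_iff)
    also have "\<dots> \<in> borel \<Otimes>\<^sub>M borel \<rightarrow>\<^sub>M borel" by measurable
    finally show ?thesis .
  qed
  have step_f: "Y (n + 1) \<omega> = f n (X (n + 1) \<omega>) (Y n \<omega>)" if "n \<ge> 1" "\<omega> \<in> space M" for n \<omega>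
    using step[OF that] by (simp only: f_def)
  note process = driven_process[where X = X and Y = Y and f = f and y = y1, OF indep f init(2) step_f]
  have Y_meas: "Y n \<in> borel_measurable M" if "n \<ge> 1" for n by (rule process(1)) (use that in auto)
  have YK: "Y n \<omega> \<in> K" if "n \<ge> 1" "\<omega> \<in> space M" for n \<omega>
  proof (cases "n = 1")
    case False
    then have "n - 1 \<ge> 1" "n - 1 + 1 = n" using that(1) by simp_all
    then show ?thesis using step[of "n - 1" \<omega>] that(2) proj(1) by simp
  qed (use init that in simp)
  obtain R where R: "\<And>y. y \<in> K \<Longrightarrow> norm (y - \<theta>) \<le> R"
    using bounded_translation[OF K, of "- \<theta>"] unfolding bounded_iff by (auto simp: algebra_simps)
  show Y_int: "integrable M (\<lambda>\<omega>. norm (Y n \<omega> - \<theta>) ^ (2 * p))" if n: "n \<ge> 1" for n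
  proof (rule integrable_const_bound[where B = "R ^ (2 * p)"])
    show "AE \<omega> in M. norm (norm (Y n \<omega> - \<theta>) ^ (2 * p)) \<le> R ^ (2 * p)"
    proof (rule AE_I2)
      fix \<omega> assume "\<omega> \<in> space M"
      then have "norm (Y n \<omega> - \<theta>) ^ (2 * p) \<le> R ^ (2 * p)" by (intro power_mono R YK n) auto
      then show "norm (norm (Y n \<omega> - \<theta>) ^ (2 * p)) \<le> R ^ (2 * p)" by simp
    qed
    have [measurable]: "Y n \<in> borel_measurable M" by (rule Y_meas[OF n])
    show "(\<lambda>\<omega>. norm (Y n \<omega> - \<theta>) ^ (2 * p)) \<in> borel_measurable M" by measurable
  qed
  have X1 [measurable]: "X 1 \<in> borel_measurable M" using indep by (simp add: indep_vars_def)
  have N: "N = distr M borel (X 1)" using law[of 1] by simp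
  interpret N: prob_space N unfolding N by (rule prob_space_distr) measurable
  have sets_N [measurable_cong]: "sets N = sets borel" by (simp add: N)
  have G_meas: "(\<lambda>x. G x y) \<in> borel_measurable N" for y
  proof -
    have "(\<lambda>x. case_prod G (x, y)) \<in> borel_measurable N" by measurable
    then show ?thesis by simp
  qed
  have V_meas: "V \<in> borel_measurable N" by measurable
  obtain B where B: "0 \<le> B" and B_le: "\<And>y g. y \<in> K \<Longrightarrow> 0 < g \<Longrightarrow> g \<le> 1 \<Longrightarrow>
    (\<integral>\<^sup>+x. ennreal (norm (y - g *\<^sub>R G x y - \<theta>) ^ (2 * p)) \<partial>N)
      \<le> ennreal ((1 - real p * \<kappa> * g) * norm (y - \<theta>) ^ (2 * p) + B * g ^ Suc p)"
  proof (rule N.expected_descent_step[where K = K, OF G_meas V_meas V1 GV int p \<kappa> mono])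
    fix B
    assume "0 \<le> B" and "\<And>y g. y \<in> K \<Longrightarrow> 0 < g \<Longrightarrow> g \<le> 1 \<Longrightarrow>
      (\<integral>\<^sup>+x. ennreal (norm (y - g *\<^sub>R G x y - \<theta>) ^ (2 * p)) \<partial>N)
        \<le> ennreal ((1 - real p * \<kappa> * g) * norm (y - \<theta>) ^ (2 * p) + B * g ^ Suc p)"
    then show thesis by (rule that)
  qed
  let ?v = "\<lambda>n. \<integral>\<omega>. norm (Y n \<omega> - \<theta>) ^ (2 * p) \<partial>M"
  \<comment> \<open>From this threshold on, both \<open>\<gamma> n \<le> 1\<close> and
    \<open>real p * \<kappa> * \<gamma> n \<le> 1\<close> hold.\<close>
  have "eventually (\<lambda>n. max 1 (real p * \<kappa>) * c \<le> real n powr \<alpha>) sequentially"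
    by (rule eventually_powr_ge[OF \<alpha>(1)])
  then have "eventually (\<lambda>n. ?v (Suc n) \<le> (1 - real p * \<kappa> * \<gamma> n) * ?v n + B * \<gamma> n ^ Suc p) sequentially"
    using eventually_ge_at_top[of 1]
  proof eventually_elim
    case (elim n)
    note n = elim(2)
    have \<gamma>0: "0 < \<gamma> n" using n c by (simp add: \<gamma>)
    have \<gamma>le: "max 1 (real p * \<kappa>) * \<gamma> n \<le> 1"
      using elim n by (simp add: \<gamma> powr_minus field_simps)
    have "1 * \<gamma> n \<le> max 1 (real p * \<kappa>) * \<gamma> n" "real p * \<kappa> * \<gamma> n \<le> max 1 (real p * \<kappa>) * \<gamma> n"
      by (rule mult_right_mono; use \<gamma>0 in simp)+
    then have \<gamma>1: "\<gamma> n \<le> 1" and \<gamma>2: "real p * \<kappa> * \<gamma> n \<le> 1"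
      using \<gamma>le by linarith+
    define F where "F z = ennreal (norm (fst z - \<gamma> n *\<^sub>R G (snd z) (fst z) - \<theta>) ^ (2 * p))" for z
    have F: "F \<in> borel_measurable (borel \<Otimes>\<^sub>M borel)"
    proof -
      have "(\<lambda>z. case_prod G (snd z, fst z)) \<in> borel_measurable (borel \<Otimes>\<^sub>M borel)" by measurable
      then have [measurable]: "(\<lambda>z. G (snd z) (fst z)) \<in> borel_measurable (borel \<Otimes>\<^sub>M borel)" by simp
      show ?thesis unfolding F_def by measurable
    qed
    let ?H = "\<lambda>\<omega>. (1 - real p * \<kappa> * \<gamma> n) * norm (Y n \<omega> - \<theta>) ^ (2 * p) + B * \<gamma> n ^ Suc p"
    have "ennreal (?v (Suc n)) = (\<integral>\<^sup>+\<omega>. ennreal (norm (Y (Suc n) \<omega> - \<theta>) ^ (2 * p)) \<partial>M)"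
      by (rule nn_integral_eq_integral[symmetric, OF Y_int]) auto
    also have "\<dots> \<le> (\<integral>\<^sup>+\<omega>. F (Y n \<omega>, X (n + 1) \<omega>) \<partial>M)"
    proof (rule nn_integral_mono)
      fix \<omega> assume "\<omega> \<in> space M"
      then have "Y (Suc n) \<omega> - \<theta> = proj (Y n \<omega> - \<gamma> n *\<^sub>R G (X (n + 1) \<omega>) (Y n \<omega>)) - proj \<theta>"
        using step[OF n] proj(2) by simp
      then have "norm (Y (Suc n) \<omega> - \<theta>) \<le> norm (Y n \<omega> - \<gamma> n *\<^sub>R G (X (n + 1) \<omega>) (Y n \<omega>) - \<theta>)"
        using proj(3) by metis
      then show "ennreal (norm (Y (Suc n) \<omega> - \<theta>) ^ (2 * p)) \<le> F (Y n \<omega>, X (n + 1) \<omega>)"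
        unfolding F_def fst_conv snd_conv by (intro ennreal_leI power_mono) auto
    qed
    also have "\<dots> = (\<integral>\<^sup>+\<omega>. (\<integral>\<^sup>+x. F (Y n \<omega>, x) \<partial>distr M borel (X (n + 1))) \<partial>M)"
      by (rule process(2)) (use n F in auto)
    also have "\<dots> = (\<integral>\<^sup>+\<omega>. (\<integral>\<^sup>+x. F (Y n \<omega>, x) \<partial>N) \<partial>M)"
      by (simp add: law)
    also have "\<dots> \<le> (\<integral>\<^sup>+\<omega>. ennreal (?H \<omega>) \<partial>M)"
    proof (rule nn_integral_mono)
      fix \<omega> assume "\<omega> \<in> space M"
      then show "(\<integral>\<^sup>+x. F (Y n \<omega>, x) \<partial>N) \<le> ennreal (?H \<omega>)"
        using B_le[OF YK[OF n] \<gamma>0 \<gamma>1] by (simp add: F_def)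
    qed
    also have "\<dots> = ennreal (\<integral>\<omega>. ?H \<omega> \<partial>M)"
      by (rule nn_integral_eq_integral) (use Y_int[OF n] \<gamma>2 \<gamma>0 B in auto)
    also have "(\<integral>\<omega>. ?H \<omega> \<partial>M) = (1 - real p * \<kappa> * \<gamma> n) * ?v n + B * \<gamma> n ^ Suc p"
      using Y_int[OF n] by (simp add: prob_space)
    finally show ?case
      using \<gamma>2 \<gamma>0 B by (subst (asm) ennreal_le_iff) (auto intro!: add_nonneg_nonneg mult_nonneg_nonneg)
  qed
  then show "\<exists>C > 0. \<forall>n\<ge>1. ?v n \<le> C / real n powr (real p * \<alpha>)"
    using robbins_monro_recursion[OF \<alpha> _ c \<gamma>, of "real p * \<kappa>" ?v B p] p \<kappa> by simp
qed

section \<open>Convergence rates for the sphere model\<close>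

lemma norm_grad_g_le: "norm (grad_g x (z, a)) \<le> 2 * (norm (x - z) + \<bar>a\<bar>)"
proof -
  have "norm (z - x - (a / norm (z - x)) *\<^sub>R (z - x)) \<le> norm (z - x) + norm ((a / norm (z - x)) *\<^sub>R (z - x))"
    by (rule norm_triangle_ineq4)
  also have "norm ((a / norm (z - x)) *\<^sub>R (z - x)) \<le> \<bar>a\<bar>" by simp
  finally have "norm (z - x - (a / norm (z - x)) *\<^sub>R (z - x)) \<le> norm (x - z) + \<bar>a\<bar>"
    by (simp add: norm_minus_commute)
  moreover have "norm (a - norm (z - x)) \<le> norm (x - z) + \<bar>a\<bar>"
    using norm_ge_zero[of "z - x"] norm_minus_commute[of z x] unfolding real_norm_def by linarith
  moreover have "norm (grad_g x (z, a))
    \<le> norm (z - x - (a / norm (z - x)) *\<^sub>R (z - x)) + norm (a - norm (z - x))"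
    unfolding grad_g_def Let_def fst_conv snd_conv by (rule norm_Pair_le)
  ultimately show ?thesis by simp
qed

text \<open>Pairing \<open>U\<close> with \<open>h\<close> can only shrink its sigma-algebra. It
  yields two real variables, to which the product formula for expectations applies.\<close>

lemma (in prob_space) indep_rvs_inner:
  fixes U :: "'a \<Rightarrow> 'b::euclidean_space"
  assumes "indep_rvs borel W borel U"
  shows "indep_var borel W borel (\<lambda>\<omega>. U \<omega> \<bullet> h)"
proof -
  let ?\<sigma> = "\<lambda>F. sigma_sets (space M) F"
  let ?gen = "\<lambda>Z. {Z -` A \<inter> space M | A. A \<in> sets borel}"
  have W [measurable]: "W \<in> borel_measurable M" and U [measurable]: "U \<in> borel_measurable M"
    and ind: "indep_set (?\<sigma> (?gen W)) (?\<sigma> (?gen U))"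
    using assms by (simp_all add: indep_rvs_def sets_vimage_algebra)
  have "?gen (\<lambda>\<omega>. U \<omega> \<bullet> h) \<subseteq> ?gen U"
  proof safe
    fix A :: "real set" assume A: "A \<in> sets borel"
    have "(\<lambda>u. u \<bullet> h) \<in> borel_measurable borel" by measurable
    then have "(\<lambda>u. u \<bullet> h) -` A \<in> sets borel"
      using A measurable_sets[of _ borel borel A] by (metis Int_UNIV_right space_borel)
    then show "\<exists>B. (\<lambda>\<omega>. U \<omega> \<bullet> h) -` A \<inter> space M = U -` B \<inter> space M \<and> B \<in> sets borel"
      by (intro exI[of _ "(\<lambda>u. u \<bullet> h) -` A"]) auto
  qed
  then have "?\<sigma> (?gen (\<lambda>\<omega>. U \<omega> \<bullet> h)) \<subseteq> ?\<sigma> (?gen U)" by (rule sigma_sets_subseteq)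
  then have "indep_set (?\<sigma> (?gen W)) (?\<sigma> (?gen (\<lambda>\<omega>. U \<omega> \<bullet> h)))"
    using ind unfolding indep_sets2_eq by blast
  then show ?thesis unfolding indep_var_eq by simp
qed

lemma power_add_le:
  fixes a b :: real
  assumes "0 \<le> a" "0 \<le> b"
  shows "(a + b) ^ q \<le> (2 * a) ^ q + (2 * b) ^ q"
proof -
  have "(a + b) ^ q \<le> (2 * max a b) ^ q" using assms by (intro power_mono) auto
  also have "\<dots> \<le> (2 * a) ^ q + (2 * b) ^ q" using assms by (auto simp: max_def)
  finally show ?thesis .
qed

theorem theorem4p2:
  fixes M :: "'w measure"
    and \<mu> :: "real^'n" and r :: real and W :: "'w \<Rightarrow> real" and U :: "'w \<Rightarrow> real^'n"
    and \<Omega> :: "(real^'n) set" and X :: "'w \<Rightarrow> real^'n"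
    and r' :: real and \<theta> :: "(real^'n) \<times> real"
    and R\<^sub>\<mu> R\<^sub>r :: real
    and K :: "((real^'n) \<times> real) set"
    and proj :: "(real^'n) \<times> real \<Rightarrow> (real^'n) \<times> real"
    and c \<alpha> :: real and \<gamma> :: "nat \<Rightarrow> real"
    and Xs :: "nat \<Rightarrow> 'w \<Rightarrow> real^'n"
    and \<theta>\<^sub>1 :: "(real^'n) \<times> real" and \<theta>h :: "nat \<Rightarrow> 'w \<Rightarrow> (real^'n) \<times> real"
    and d_min :: real
  assumes "prob_space M"
    and "CARD('n) \<ge> 2"
    \<comment> \<open>the model\<close>
    and "r > 0"
    and W_pos: "AE \<omega> in M. W \<omega> > 0"
    and W_continuous: "\<And>w. measure M {\<omega> \<in> space M. W \<omega> = w} = 0"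
    and W_density: "CARD('n) = 2 \<Longrightarrow>
          \<exists>f b. distributed M lborel W f \<and> (\<forall>w. f w \<le> ennreal b)"
    and "\<Omega> \<in> sets borel" and "\<Omega> \<subseteq> sphere 0 1" and "emeasure sphere_measure \<Omega> > 0"
    and U_uniform: "distr M borel U = uniform_measure sphere_measure \<Omega>"
    and W_U_indep: "prob_space.indep_rvs M borel W borel U"
    and X_eq: "\<And>\<omega>. \<omega> \<in> space M \<Longrightarrow> X \<omega> = \<mu> + (r * W \<omega>) *\<^sub>R U \<omega>"
    and r'_eq: "r' = r * (\<integral>\<omega>. W \<omega> \<partial>M)"
    and \<theta>_eq: "\<theta> = (\<mu>, r')"
    \<comment> \<open>the assumptions [A1], [A2], [A3]\<close>
    and A1: "integrable M (\<lambda>\<omega>. 1 / (norm (X \<omega> - \<mu>))\<^sup>2)"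
    and A2: "integrable M (\<lambda>\<omega>. (norm (X \<omega> - \<mu>))\<^sup>2)"
    and "R\<^sub>\<mu> > 0" and "R\<^sub>r > 0"
    and A3: "\<exists>A. (norm (\<integral>\<omega>. U \<omega> \<partial>M))\<^sup>2 < A \<and> A < 1 \<and>
          (SUP z \<in> cball \<mu> R\<^sub>\<mu>. ereal (lambda_max (Gamma_mat M X z)))
            < ereal ((1 - (norm (\<integral>\<omega>. U \<omega> \<partial>M))\<^sup>2 / A) / (r' + 3 / 2 * R\<^sub>r))"
    \<comment> \<open>the compact set and the projection\<close>
    and "compact K" and "convex K"
    and "K \<subseteq> UNIV \<times> {0<..}"
    and "K \<subseteq> cball \<mu> R\<^sub>\<mu> \<times> cball r' R\<^sub>r"
    and "\<theta> \<in> K - frontier K"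
    and "\<And>y. proj y \<in> K"
    and "\<And>y. y \<in> K \<Longrightarrow> proj y = y"
    and "\<And>y y'. norm (proj y - proj y') \<le> norm (y - y')"
    and "\<And>y. y \<notin> K \<Longrightarrow> proj y \<in> frontier K"
    \<comment> \<open>the sample and the algorithm\<close>
    and Xs_indep: "prob_space.indep_vars M (\<lambda>_. borel) Xs {1..}"
    and Xs_law: "\<And>n. n \<ge> 1 \<Longrightarrow> distr M borel (Xs n) = distr M borel X"
    and "c > 0" and "1 / 2 < \<alpha>" and "\<alpha> < 1"
    and \<gamma>_eq: "\<And>n. n \<ge> 1 \<Longrightarrow> \<gamma> n = c * real n powr (- \<alpha>)"
    and "\<theta>\<^sub>1 \<in> K"
    and \<theta>h_1: "\<And>\<omega>. \<omega> \<in> space M \<Longrightarrow> \<theta>h 1 \<omega> = \<theta>\<^sub>1"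
    and \<theta>h_step: "\<And>n \<omega>. n \<ge> 1 \<Longrightarrow> \<omega> \<in> space M \<Longrightarrow>
          \<theta>h (n + 1) \<omega> = proj (\<theta>h n \<omega> - \<gamma> n *\<^sub>R grad_g (Xs (n + 1) \<omega>) (\<theta>h n \<omega>))"
    and d_min_eq: "d_min = (INF y \<in> frontier K. norm (y - \<theta>))"
  shows "(\<exists>C\<^sub>1 > 0. \<forall>n\<ge>1.
            (\<integral>\<omega>. (norm (\<theta>h n \<omega> - \<theta>))\<^sup>2 \<partial>M) \<le> C\<^sub>1 / real n powr \<alpha>) \<and>
         (\<forall>p::nat. p \<ge> 1 \<longrightarrow> integrable M (\<lambda>\<omega>. norm (X \<omega> - \<mu>) ^ (2 * p)) \<longrightarrow>
           (\<exists>C\<^sub>p > 0.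
              (\<forall>n\<ge>1. (\<integral>\<omega>. norm (\<theta>h n \<omega> - \<theta>) ^ (2 * p) \<partial>M)
                        \<le> C\<^sub>p / real n powr (real p * \<alpha>)) \<and>
              (\<forall>n\<ge>1. measure M {\<omega> \<in> space M.
                          \<theta>h n \<omega> - \<gamma> n *\<^sub>R grad_g (Xs (n + 1) \<omega>) (\<theta>h n \<omega>) \<notin> K}
                        \<le> C\<^sub>p / (d_min ^ (2 * p) * real n powr (real p * \<alpha>)))))"
proof -
  interpret prob_space M by fact
  have [measurable]: "W \<in> borel_measurable M" and U_meas [measurable]: "U \<in> borel_measurable M"
    using W_U_indep by (simp_all add: indep_rvs_def)
  have X_meas [measurable]: "X \<in> borel_measurable M"
    by (subst measurable_cong[OF X_eq]) measurable

  \<comment> \<open>Radius, direction and mean of \<open>X - \<mu>\<close>\<close>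
  have U_\<Omega>: "AE \<omega> in M. U \<omega> \<in> \<Omega>"
  proof -
    have "\<Omega> \<in> sets (sphere_measure :: (real^'n) measure)"
      using \<open>\<Omega> \<in> sets borel\<close> by (simp add: sphere_measure_def)
    then have "AE u in distr M borel U. u \<in> \<Omega>"
      unfolding U_uniform by (intro AE_uniform_measureI) auto
    then show ?thesis by (rule AE_distrD[OF U_meas])
  qed
  have U1: "AE \<omega> in M. norm (U \<omega>) = 1"
    using U_\<Omega> by eventually_elim (use \<open>\<Omega> \<subseteq> sphere 0 1\<close> in auto)
  have X_norm: "AE \<omega> in M. norm (X \<omega> - \<mu>) = r * W \<omega>"
    using U1 W_pos AE_space
  proof eventually_elim
    case (elim \<omega>)
    then show ?case using \<open>r > 0\<close> by (simp add: X_eq abs_mult)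
  qed
  have X_sgn: "AE \<omega> in M. sgn (X \<omega> - \<mu>) = U \<omega>"
    using U1 W_pos AE_space
  proof eventually_elim
    case (elim \<omega>)
    then show ?case using \<open>r > 0\<close> by (simp add: X_eq sgn_scaleR sgn_mult sgn_div_norm[of "U \<omega>"])
  qed
  have W_ne: "AE \<omega> in M. W \<omega> \<noteq> w" for w
    using prob_eq_0[of "{\<omega> \<in> space M. W \<omega> = w}"] W_continuous[of w] AE_space
    by (auto elim: eventually_elim2)
  \<comment> \<open>The value \<open>z\<close> would fix the radius, and \<open>W\<close> has no
    atoms.\<close>
  have nonatomic: "AE \<omega> in M. X \<omega> \<noteq> z" for z
    using X_norm W_ne[of "norm (z - \<mu>) / r"]
    by eventually_elim (use \<open>r > 0\<close> in \<open>auto simp: field_simps\<close>)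
  have X_int: "integrable M (\<lambda>\<omega>. norm (X \<omega> - \<mu>))"
  proof (rule Bochner_Integration.integrable_bound)
    show "integrable M (\<lambda>\<omega>. 1 + (norm (X \<omega> - \<mu>))\<^sup>2)" using A2 by simp
    have "t \<le> 1 + t\<^sup>2" for t :: real using zero_le_power2[of "t - 1"] zero_le_power2[of t]
      unfolding power2_diff one_power2 mult_1_right by linarith
    then show "AE \<omega> in M. norm (norm (X \<omega> - \<mu>)) \<le> norm (1 + (norm (X \<omega> - \<mu>))\<^sup>2)" by simp
  qed measurable
  have W_int: "integrable M W"
  proof -
    have "integrable M (\<lambda>\<omega>. norm (X \<omega> - \<mu>) / r)" using X_int by simp
    moreover have "AE \<omega> in M. norm (X \<omega> - \<mu>) / r = W \<omega>"
      using X_norm by eventually_elim (use \<open>r > 0\<close> in simp)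
    ultimately show ?thesis
      by (intro integrable_cong_AE_imp[where f = W]) measurable
  qed
  have r'_norm: "r' = (\<integral>\<omega>. norm (X \<omega> - \<mu>) \<partial>M)"
  proof -
    have "(\<integral>\<omega>. norm (X \<omega> - \<mu>) \<partial>M) = (\<integral>\<omega>. r * W \<omega> \<partial>M)"
      by (rule integral_cong_AE) (measurable, rule X_norm)
    then show ?thesis by (simp add: r'_eq)
  qed
  have r'0: "0 \<le> r'" by (simp add: r'_norm)
  define u where "u = (\<integral>\<omega>. U \<omega> \<partial>M)"
  have U_int: "integrable M U"
    by (rule integrable_const_bound[where B = 1]) (use U1 in \<open>auto\<close>)
  have u_sgn: "u = (\<integral>\<omega>. sgn (X \<omega> - \<mu>) \<partial>M)"
    unfolding u_def by (rule integral_cong_AE[symmetric]) (measurable, rule X_sgn)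
  \<comment> \<open>The vector identity is tested against every \<open>h\<close>, where independence
    factors the real expectation of \<open>W \<omega> * (U \<omega> \<bullet> h)\<close>.\<close>
  have mean: "(\<integral>\<omega>. X \<omega> - \<mu> \<partial>M) = r' *\<^sub>R u"
  proof -
    have X_int': "integrable M (\<lambda>\<omega>. X \<omega> - \<mu>)"
      using X_int by (subst (asm) integrable_norm_iff) measurable
    have "(\<integral>\<omega>. X \<omega> - \<mu> \<partial>M) \<bullet> h = (r' *\<^sub>R u) \<bullet> h" for h
    proof -
      have "(\<integral>\<omega>. X \<omega> - \<mu> \<partial>M) \<bullet> h = (\<integral>\<omega>. (X \<omega> - \<mu>) \<bullet> h \<partial>M)"
        using X_int' by simp
      also have "\<dots> = (\<integral>\<omega>. r * (W \<omega> * (U \<omega> \<bullet> h)) \<partial>M)"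
        by (rule Bochner_Integration.integral_cong) (simp_all add: X_eq)
      also have "\<dots> = r * ((\<integral>\<omega>. W \<omega> \<partial>M) * (\<integral>\<omega>. U \<omega> \<bullet> h \<partial>M))"
        using indep_var_lebesgue_integral[OF indep_rvs_inner[OF W_U_indep] W_int, of h] U_int by simp
      also have "\<dots> = (r' *\<^sub>R u) \<bullet> h" using U_int by (simp add: r'_eq u_def)
      finally show ?thesis .
    qed
    then show ?thesis by (rule vector_eq_rdot[THEN iffD1, OF allI])
  qed
  obtain A where A: "(norm u)\<^sup>2 < A" "A < 1"
    and sup: "(SUP z \<in> cball \<mu> R\<^sub>\<mu>. ereal (lambda_max (Gamma_mat M X z)))
      < ereal ((1 - (norm u)\<^sup>2 / A) / (r' + 3 / 2 * R\<^sub>r))"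
    using A3 unfolding u_def by blast
  \<comment> \<open>A real number strictly between the extended-real supremum and the bound of
    [A3].\<close>
  obtain L where L: "(SUP z \<in> cball \<mu> R\<^sub>\<mu>. ereal (lambda_max (Gamma_mat M X z))) < ereal L"
    and L_less: "ereal L < ereal ((1 - (norm u)\<^sup>2 / A) / (r' + 3 / 2 * R\<^sub>r))"
    using ereal_dense2[OF sup] by blast
  have L_le: "lambda_max (Gamma_mat M X z) \<le> L" if "z \<in> cball \<mu> R\<^sub>\<mu>" for z
  proof -
    have "ereal (lambda_max (Gamma_mat M X z)) \<le> (SUP z \<in> cball \<mu> R\<^sub>\<mu>. ereal (lambda_max (Gamma_mat M X z)))"
      using that by (rule SUP_upper)
    also note L
    finally show ?thesis by simp
  qed
  have A0: "0 < A" using A(1) zero_le_power2[of "norm u"] by linarith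
  \<comment> \<open>The smaller of the two monotonicity coefficients, for the centre and for the
    radius.\<close>
  define \<kappa> where "\<kappa> = min (1 - (norm u)\<^sup>2 / A - L * (r' + 3 / 2 * R\<^sub>r)) (1 - A)"
  have \<kappa>0: "0 < \<kappa>"
  proof -
    have "0 < r' + 3 / 2 * R\<^sub>r" using r'0 \<open>R\<^sub>r > 0\<close> by simp
    then have "L * (r' + 3 / 2 * R\<^sub>r) < 1 - (norm u)\<^sup>2 / A" using L_less by (simp add: pos_less_divide_eq)
    then show ?thesis using A(2) by (simp add: \<kappa>_def)
  qed
  define N where "N = distr M borel X"
  have K_in: "fst y \<in> cball \<mu> R\<^sub>\<mu>" "snd y \<in> cball r' R\<^sub>r" if "y \<in> K" for y
    using that \<open>K \<subseteq> cball \<mu> R\<^sub>\<mu> \<times> cball r' R\<^sub>r\<close> by auto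
  have mono: "\<kappa> * (norm (y - \<theta>))\<^sup>2 \<le> (\<integral>x. grad_g x y \<bullet> (y - \<theta>) \<partial>N)" if y: "y \<in> K" for y
  proof -
    obtain z a where za: "y = (z, a)" by (cases y)
    have z: "z \<in> cball \<mu> R\<^sub>\<mu>" and a: "a \<le> r' + R\<^sub>r"
      using K_in[OF y] by (auto simp: za dist_real_def)
    have "\<kappa> * (norm (y - \<theta>))\<^sup>2 = \<kappa> * (norm (z - \<mu>))\<^sup>2 + \<kappa> * (a - r')\<^sup>2"
      by (simp add: za \<theta>_eq norm_Pair algebra_simps)
    also have "\<dots> \<le> (1 - (norm u)\<^sup>2 / A - L * (r' + 3 / 2 * R\<^sub>r)) * (norm (z - \<mu>))\<^sup>2 + (1 - A) * (a - r')\<^sup>2"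
      by (intro add_mono mult_right_mono) (auto simp: \<kappa>_def)
    also have "\<dots> \<le> (\<integral>\<omega>. grad_g (X \<omega>) (z, a) \<bullet> ((z, a) - (\<mu>, r')) \<partial>M)"
      by (rule grad_g_strongly_monotone[OF X_meas nonatomic \<open>CARD('n) \<ge> 2\<close> \<open>R\<^sub>\<mu> > 0\<close> \<open>R\<^sub>r > 0\<close>
            L_le X_int r'_norm u_sgn mean z a A0])
    also have "\<dots> = (\<integral>x. grad_g x y \<bullet> (y - \<theta>) \<partial>N)"
      unfolding N_def za \<theta>_eq by (rule integral_distr[symmetric]) measurable
    finally show ?thesis .
  qed
  \<comment> \<open>An envelope of the gradient over \<open>K\<close>, from
    \<open>norm (\<mu> - z) \<le> R\<^sub>\<mu>\<close> and
    \<open>\<bar>a\<bar> \<le> r' + R\<^sub>r\<close>; the extra 1 ensures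
    \<open>1 \<le> V x\<close>.\<close>
  define V where "V x = 2 * norm (x - \<mu>) + (1 + 2 * (R\<^sub>\<mu> + r' + R\<^sub>r))" for x
  have V1: "1 \<le> V x" for x
    using \<open>R\<^sub>\<mu> > 0\<close> \<open>R\<^sub>r > 0\<close> r'0 by (simp add: V_def)
  have V_meas: "V \<in> borel_measurable borel" unfolding V_def[abs_def] by measurable
  have grad_V: "norm (grad_g x y) \<le> V x" if y: "y \<in> K" for x y
  proof -
    obtain z a where za: "y = (z, a)" by (cases y)
    have "norm (\<mu> - z) \<le> R\<^sub>\<mu>" "\<bar>a\<bar> \<le> r' + R\<^sub>r"
      using K_in[OF y] r'0 by (auto simp: za dist_norm dist_real_def)
    moreover have "norm (x - z) \<le> norm (x - \<mu>) + norm (\<mu> - z)"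
      using norm_triangle_ineq[of "x - \<mu>" "\<mu> - z"] by simp
    ultimately show ?thesis using norm_grad_g_le[of x z a] by (simp add: za V_def)
  qed
  have V_int: "integrable N (\<lambda>x. V x ^ (2 * p))"
    if int: "integrable M (\<lambda>\<omega>. norm (X \<omega> - \<mu>) ^ (2 * p))" for p
  proof -
    let ?c = "1 + 2 * (R\<^sub>\<mu> + r' + R\<^sub>r)"
    have "integrable M (\<lambda>\<omega>. V (X \<omega>) ^ (2 * p))"
    proof (rule Bochner_Integration.integrable_bound)
      show "integrable M (\<lambda>\<omega>. 4 ^ (2 * p) * norm (X \<omega> - \<mu>) ^ (2 * p) + (2 * ?c) ^ (2 * p))"
        using int by simp
      show "AE \<omega> in M. norm (V (X \<omega>) ^ (2 * p))
        \<le> norm (4 ^ (2 * p) * norm (X \<omega> - \<mu>) ^ (2 * p) + (2 * ?c) ^ (2 * p))"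
      proof (rule AE_I2)
        fix \<omega>
        have "V (X \<omega>) ^ (2 * p) \<le> (2 * (2 * norm (X \<omega> - \<mu>))) ^ (2 * p) + (2 * ?c) ^ (2 * p)"
          unfolding V_def by (rule power_add_le) (use \<open>R\<^sub>\<mu> > 0\<close> \<open>R\<^sub>r > 0\<close> r'0 in auto)
        also have "(2 * (2 * norm (X \<omega> - \<mu>))) ^ (2 * p) = 4 ^ (2 * p) * norm (X \<omega> - \<mu>) ^ (2 * p)"
          unfolding power_mult_distrib[symmetric] by simp
        finally show "norm (V (X \<omega>) ^ (2 * p))
          \<le> norm (4 ^ (2 * p) * norm (X \<omega> - \<mu>) ^ (2 * p) + (2 * ?c) ^ (2 * p))"
          using V1[of "X \<omega>"] by (simp add: abs_of_nonneg)
      qed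
    qed (use V_meas in measurable)
    then show ?thesis
      unfolding N_def by (subst integrable_distr_eq) (use V_meas in measurable)
  qed
  have \<theta>: "\<theta> \<in> K" "\<theta> \<notin> frontier K" using \<open>\<theta> \<in> K - frontier K\<close> by auto
  have moment: "(\<forall>n\<ge>1. integrable M (\<lambda>\<omega>. norm (\<theta>h n \<omega> - \<theta>) ^ (2 * p))) \<and>
    (\<exists>C>0. \<forall>n\<ge>1. (\<integral>\<omega>. norm (\<theta>h n \<omega> - \<theta>) ^ (2 * p) \<partial>M) \<le> C / real n powr (real p * \<alpha>))"
    if p: "1 \<le> p" and int: "integrable M (\<lambda>\<omega>. norm (X \<omega> - \<mu>) ^ (2 * p))" for p
  proof -
    have law: "distr M borel (Xs n) = N" if "n \<ge> 1" for n
      using Xs_law[OF that] by (simp add: N_def)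
    have G: "case_prod grad_g \<in> borel \<Otimes>\<^sub>M borel \<rightarrow>\<^sub>M borel"
    proof -
      have "case_prod grad_g = (\<lambda>z. grad_g (fst z) (snd z))" by (simp add: fun_eq_iff)
      also have "\<dots> \<in> borel \<Otimes>\<^sub>M borel \<rightarrow>\<^sub>M borel" by measurable
      finally show ?thesis .
    qed
    note rm = projected_robbins_monro_moment_le[where X = Xs and Y = \<theta>h and K = K and proj = proj
        and \<theta> = \<theta> and G = grad_g and V = V and N = N and \<gamma> = \<gamma> and p = p,
        OF Xs_indep law G compact_imp_bounded[OF \<open>compact K\<close>] \<open>\<And>y. proj y \<in> K\<close>
          \<open>\<And>y. y \<in> K \<Longrightarrow> proj y = y\<close>[OF \<theta>(1)] \<open>\<And>y y'. norm (proj y - proj y') \<le> norm (y - y')\<close>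
          \<open>\<theta>\<^sub>1 \<in> K\<close> \<theta>h_1 \<theta>h_step V_meas V1 grad_V V_int[OF int] p \<kappa>0 mono _ \<open>\<alpha> < 1\<close> \<open>c > 0\<close> \<gamma>_eq]
    show ?thesis using rm \<open>1 / 2 < \<alpha>\<close> by auto
  qed
  \<comment> \<open>An exit at step \<open>n\<close> puts the iterate \<open>n + 1\<close> on the
    frontier, at distance at least \<open>d_min\<close> from \<open>\<theta>\<close>, so the moment
    bound at \<open>n + 1\<close> is the one to use.\<close>
  have exit_le: "measure M {\<omega> \<in> space M. \<theta>h n \<omega> - \<gamma> n *\<^sub>R grad_g (Xs (n + 1) \<omega>) (\<theta>h n \<omega>) \<notin> K}
      \<le> C / (d_min ^ (2 * p) * real n powr (real p * \<alpha>))"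
    if p: "1 \<le> p" and n: "1 \<le> n" and C: "0 < C"
      and int: "integrable M (\<lambda>\<omega>. norm (\<theta>h (n + 1) \<omega> - \<theta>) ^ (2 * p))"
      and bound: "(\<integral>\<omega>. norm (\<theta>h (n + 1) \<omega> - \<theta>) ^ (2 * p) \<partial>M) \<le> C / real (n + 1) powr (real p * \<alpha>)"
    for p n C
  proof (cases "frontier K = {}")
    \<comment> \<open>Without a frontier no point lies outside \<open>K\<close>, so the event is
      empty. The even power makes the right side nonnegative whatever the value of
      \<open>d_min\<close>, an infimum over the empty set.\<close>
    case True
    then have "y \<in> K" for y
      using \<open>\<And>y. y \<notin> K \<Longrightarrow> proj y \<in> frontier K\<close>[of y] by blast
    then have "{\<omega> \<in> space M. \<theta>h n \<omega> - \<gamma> n *\<^sub>R grad_g (Xs (n + 1) \<omega>) (\<theta>h n \<omega>) \<notin> K} = {}"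
      by simp
    moreover have "0 \<le> C / (d_min ^ (2 * p) * real n powr (real p * \<alpha>))"
      using C by (intro divide_nonneg_nonneg mult_nonneg_nonneg) (simp_all add: zero_le_even_power)
    ultimately show ?thesis by (simp only: measure_empty)
  next
    case False
    \<comment> \<open>The frontier is closed and misses \<open>\<theta>\<close>, hence
      \<open>d_min\<close> is positive.\<close>
    obtain e where e: "0 < e" "\<And>y. y \<in> frontier K \<Longrightarrow> e \<le> dist \<theta> y"
      using separate_point_closed[OF frontier_closed \<theta>(2)] by blast
    have "e \<le> d_min"
      unfolding d_min_eq using False e(2) by (intro cINF_greatest) (auto simp: dist_norm norm_minus_commute)
    then have d0: "0 < d_min" using e(1) by linarith
    have d_le: "d_min \<le> norm (y - \<theta>)" if "y \<in> frontier K" for y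
      unfolding d_min_eq using that by (intro cINF_lower) (auto intro!: bdd_belowI[where m = 0])
    \<comment> \<open>Only this larger event has to be measurable for the comparison of
      measures.\<close>
    let ?S = "{\<omega> \<in> space M. d_min ^ (2 * p) \<le> norm (\<theta>h (n + 1) \<omega> - \<theta>) ^ (2 * p)}"
    have S: "?S \<in> sets M"
      using borel_measurable_integrable[OF int] by measurable
    have "measure M {\<omega> \<in> space M. \<theta>h n \<omega> - \<gamma> n *\<^sub>R grad_g (Xs (n + 1) \<omega>) (\<theta>h n \<omega>) \<notin> K} \<le> measure M ?S"
    proof (rule finite_measure_mono[OF _ S], safe)
      fix \<omega> assume \<omega>: "\<omega> \<in> space M" "\<theta>h n \<omega> - \<gamma> n *\<^sub>R grad_g (Xs (n + 1) \<omega>) (\<theta>h n \<omega>) \<notin> K"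
      then have "\<theta>h (n + 1) \<omega> \<in> frontier K"
        using \<theta>h_step[OF n \<omega>(1)] \<open>\<And>y. y \<notin> K \<Longrightarrow> proj y \<in> frontier K\<close> by simp
      then show "d_min ^ (2 * p) \<le> norm (\<theta>h (n + 1) \<omega> - \<theta>) ^ (2 * p)"
        using d_le d0 by (intro power_mono) auto
    qed
    also have "\<dots> \<le> (\<integral>\<omega>. norm (\<theta>h (n + 1) \<omega> - \<theta>) ^ (2 * p) \<partial>M) / d_min ^ (2 * p)"
      by (rule integral_Markov_inequality_measure[OF int, of "space M"]) (use d0 in auto)
    also have "\<dots> \<le> (C / real n powr (real p * \<alpha>)) / d_min ^ (2 * p)"
    proof (rule divide_right_mono)
      have "real n powr (real p * \<alpha>) \<le> real (n + 1) powr (real p * \<alpha>)"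
        using \<open>1 / 2 < \<alpha>\<close> by (intro powr_mono2) auto
      then have "C / real (n + 1) powr (real p * \<alpha>) \<le> C / real n powr (real p * \<alpha>)"
        using C n by (intro divide_left_mono) auto
      then show "(\<integral>\<omega>. norm (\<theta>h (n + 1) \<omega> - \<theta>) ^ (2 * p) \<partial>M) \<le> C / real n powr (real p * \<alpha>)"
        using bound by linarith
    qed (use d0 in simp)
    finally show ?thesis by (simp add: mult.commute)
  qed
  show ?thesis
  proof (intro conjI allI impI)
    show "\<exists>C\<^sub>1>0. \<forall>n\<ge>1. (\<integral>\<omega>. (norm (\<theta>h n \<omega> - \<theta>))\<^sup>2 \<partial>M) \<le> C\<^sub>1 / real n powr \<alpha>"
      using moment[of 1] A2 by simp
  next
    fix p :: nat
    assume p: "1 \<le> p" and int: "integrable M (\<lambda>\<omega>. norm (X \<omega> - \<mu>) ^ (2 * p))"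
    obtain C where C: "C > 0" "\<And>n. n \<ge> 1 \<Longrightarrow> (\<integral>\<omega>. norm (\<theta>h n \<omega> - \<theta>) ^ (2 * p) \<partial>M) \<le> C / real n powr (real p * \<alpha>)"
      using moment[OF p int] by blast
    have "measure M {\<omega> \<in> space M. \<theta>h n \<omega> - \<gamma> n *\<^sub>R grad_g (Xs (n + 1) \<omega>) (\<theta>h n \<omega>) \<notin> K}
      \<le> C / (d_min ^ (2 * p) * real n powr (real p * \<alpha>))" if n: "1 \<le> n" for n
      by (rule exit_le[OF p n C(1)]) (use moment[OF p int] C(2)[of "n + 1"] in auto)
    then show "\<exists>C\<^sub>p>0.
       (\<forall>n\<ge>1. (\<integral>\<omega>. norm (\<theta>h n \<omega> - \<theta>) ^ (2 * p) \<partial>M) \<le> C\<^sub>p / real n powr (real p * \<alpha>)) \<and>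
       (\<forall>n\<ge>1. measure M {\<omega> \<in> space M.
                  \<theta>h n \<omega> - \<gamma> n *\<^sub>R grad_g (Xs (n + 1) \<omega>) (\<theta>h n \<omega>) \<notin> K}
                \<le> C\<^sub>p / (d_min ^ (2 * p) * real n powr (real p * \<alpha>)))"
      using C by blast
  qed
qed

end
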